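(* Let $X$ be a uniformly ergodic time-homogeneous Markov chain on $\mathcal{X}$ under $\mathbb{P}$ with transition matrix $A$, let $\gamma\in(0,1)$, and let $f:\mathcal{X}\times\mathbb{R}^N\to\mathbb{R}$ be a function such that the driver $(\omega,t,z)\mapsto f(X_t(\omega),z)$ is $\gamma$-balanced. Let $x_0\in\mathcal{X}$ be an arbitrary state. For $\alpha>0$ let $v^\alpha:\mathcal{X}\to\mathbb{R}$ be the function representing the unique bounded solution of the discounted BSDE with parameter $\alpha$ and driver $f$ (see context). Let $\alpha_n\searrow 0$ be a sequence, $\lambda\in\mathbb{R}$ and $v:\mathcal{X}\to\mathbb{R}$ such that, for all $x\in\mathcal{X}$, $v^{\alpha_n}(x)-v^{\alpha_n}(x_0)\to v(x)$ and $\alpha_n v^{\alpha_n}(x)\to\lambda$ as $n\to\infty$ (such a sequence and limits exist). Then the triple $(Y,Z,\lambda)$ with $$Y_t:=v(X_t),\qquad e_k^{*}Z_t:=v(e_k)\quad (k=1,\dots,N)$$ is the unique bounded, stationary, Markovian solution, with $v(x_0)=0$, of the Ergodic BSDE $$Y_T=Y_t-\sum_{t\le u<T}\big(f(X_u,Z_u)-\lambda\big)+\sum_{t\le u<T}Z_u^{*}M_{u+1}\quad\text{a.s. for all } 0\le t<T<\infty$$ (uniqueness being up to indistinguishability for $Y$ and up to $\sim_M$ for $Z$). Moreover, any other bounded solution $(Y',Z',\lambda')$ satisfies $\lambda=\lambda'$, and any other bounded, stationary, Markovian solution $(Y',Z',\lambda')$ satisfies $Y_t=Y'_t+c$ for some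 constant $c\in\mathbb{R}$, and $Z\sim_M Z'$.
   Context: Setting. $\mathcal{X}=\{e_1,\dots,e_N\}$ is the standard basis of $\mathbb{R}^N$ (column vectors; $*$ is transposition), $X=(X_t)_{t\ge0}$ is an $\mathcal{X}$-valued process in discrete time $t\in\{0,1,2,\dots\}$ on a probability space $(\Omega,\mathcal{F},\mathbb{P})$, $\mathcal{F}_t$ is the $\mathbb{P}$-completion of $\sigma(X_0,\dots,X_t)$ (adding only subsets of null sets of $\sigma(X_0,\dots,X_t)$), and $\mathcal{F}=\sigma(\bigcup_t\mathcal{F}_t)$. Adapted means $\mathcal{F}_t$-measurable at each time $t$. Transition matrices are column-stochastic: $A=[a_{ij}]$, $a_{ij}=\mathbb{P}(X_{t+1}=e_i\mid X_t=e_j)$, so $\mathbb{E}[X_{t+1}\mid\mathcal{F}_t]=AX_t$. Put $M_{t+1}:=X_{t+1}-AX_t$. For $\mathcal{F}_t$-measurable $\mathbb{R}^N$-valued $Z_t$, $\|Z_t\|_{M_{t+1}}^2:=\mathbb{E}[(Z_t^*M_{t+1})^2\mid\mathcal{F}_t]$. For adapted $Z,Z'$, $Z\sim_M Z'$ means $\|Z_t-Z'_t\|_{M_{t+1}}=0$ a.s. for all $t\ge0$. Uniform ergodicity: a time-homogeneous chain with $P_t\mu$ denoting the law of $X_t$ given $X_0\sim\mu$ is uniformly ergodic if there are a probability measure $\pi$ on $\mathcal{X}$ and $R,\rho>0$ with $\sup_\mu\|P_t\mu-\pi\|_{TV}\le Re^{-\rho t}$ for all $t\ge0$, the supremum being over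 probability measures on $\mathcal{X}$, where $\|\mu\|_{TV}=\frac12\sum_{x}|\mu(\{x\})|$. $\gamma$-balanced: a driver $f(\omega,t,z)$ (adapted: $(\omega,z)\mapsto f(\omega,t,z)$ is $\mathcal{F}_t\otimes\mathcal{B}(\mathbb{R}^N)$-measurable for each $t$) is $\gamma$-balanced if there is a map $\psi:\Omega\times\mathbb{N}\times\mathbb{R}^N\times\mathbb{R}^N\to\mathbb{R}^N$, adapted in the same sense, such that for all $t\ge0$, $z,z'\in\mathbb{R}^N$ and almost all $\omega$: (i) $f(\omega,t,z)-f(\omega,t,z')=(z-z')^*(\psi(\omega,t,z,z')-AX_t)$; (ii) for each $i$, $\frac{e_i^*\psi(\omega,t,z,z')}{e_i^*AX_t}\in[\gamma,\gamma^{-1}]$, with $0/0:=1$; (iii) the entries of $\psi(\omega,t,z,z')$ sum to $1$. Discounted BSDE: for each $\alpha>0$ there is a unique adapted solution $(Y^\alpha,Z^\alpha)$ with $Y^\alpha$ uniformly bounded (unique up to indistinguishability for $Y^\alpha$, $\sim_M$ for $Z^\alpha$) of $Y^\alpha_T=Y^\alpha_t-\sum_{t\le u<T}(f(X_u,Z^\alpha_u)-\alpha Y^\alpha_u)+\sum_{t\le u<T}(Z^\alpha_u)^*M_{u+1}$ a.s. for all $0\le t<T<\infty$, and there is a function $v^\alpha:\mathcal{X}\to\mathbb{R}$ with $Y^\alpha_t=v^\alpha(X_t)$ and (up to $\sim_M$) $e_k^*Z^\alpha_t=v^\alpha(e_k)$. A solution of the Ergodic BSDE is a triple $(Y,Z,\lambda)$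 with $Y$ (real-valued) and $Z$ ($\mathbb{R}^N$-valued) adapted and $\lambda\in\mathbb{R}$ a constant. It is bounded if $Y$ is uniformly bounded, and stationary Markovian if $Y_t$ and $Z_t$ are given by deterministic functions of $X_t$ which do not depend on $t$ (so $Y_t=v(X_t)$ for some $v:\mathcal{X}\to\mathbb{R}$).
   Formalization: Uniqueness under v(x_0)=0 is stated only if the chain visits x_0 with positive probability, and existence of the sequence and limits only if it visits every state with positive probability; otherwise v^α and v are not determined at unvisited states and these two claims fail. *)

theory Defs
  imports "HOL-Probability.Probability"
begin

section \<open>State space, filtration and Markov chain\<close>

abbreviation e :: "'n \<Rightarrow> real ^ 'n::finite" where
  "e i \<equiv> axis i 1"

definition states :: "(real ^ 'n::finite) set" where
  "states = range e"

definition raw_filt :: "'a measure \<Rightarrow> (nat \<Rightarrow> 'a \<Rightarrow> real ^ 'n::finite) \<Rightarrow> nat \<Rightarrow> 'a measure" where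
  "raw_filt P X t = sigma (space P) {X s -` B \<inter> space P | s B. s \<le> t \<and> B \<in> sets borel}"

text \<open>Completing the restriction of \<open>P\<close> to \<open>\<sigma>(X\<^sub>0,\<dots>,X\<^sub>t)\<close>, rather than \<open>P\<close> itself, adds only
  the subsets of null sets that already belong to \<open>\<sigma>(X\<^sub>0,\<dots>,X\<^sub>t)\<close>.\<close>

definition filt :: "'a measure \<Rightarrow> (nat \<Rightarrow> 'a \<Rightarrow> real ^ 'n::finite) \<Rightarrow> nat \<Rightarrow> 'a measure" where
  "filt P X t = completion (restr_to_subalg P (raw_filt P X t))"

definition adapted ::
  "'a measure \<Rightarrow> (nat \<Rightarrow> 'a \<Rightarrow> real ^ 'n::finite) \<Rightarrow> (nat \<Rightarrow> 'a \<Rightarrow> 'b::topological_space) \<Rightarrow> bool" where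
  "adapted P X Y \<longleftrightarrow> (\<forall>t. Y t \<in> borel_measurable (filt P X t))"

definition column_stochastic :: "real ^ 'n ^ 'n::finite \<Rightarrow> bool" where
  "column_stochastic A \<longleftrightarrow> (\<forall>i j. A $ i $ j \<ge> 0) \<and> (\<forall>j. (\<Sum>i\<in>UNIV. A $ i $ j) = 1)"

text \<open>On \<open>{X\<^sub>t = e\<^sub>j}\<close> the number \<open>(A *v X t \<omega>) $ i\<close> is \<open>A $ i $ j\<close>, so the last clause combines the
  Markov property with time-homogeneity and the transition probabilities \<open>a\<^sub>i\<^sub>j\<close>. The law of \<open>X\<^sub>0\<close>
  is arbitrary.\<close>

definition markov_chain ::
  "'a measure \<Rightarrow> (nat \<Rightarrow> 'a \<Rightarrow> real ^ 'n::finite) \<Rightarrow> real ^ 'n ^ 'n \<Rightarrow> bool" where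
  "markov_chain P X A \<longleftrightarrow>
     column_stochastic A \<and>
     (\<forall>t. X t \<in> borel_measurable P \<and> (\<forall>\<omega>\<in>space P. X t \<omega> \<in> states)) \<and>
     (\<forall>t i. AE \<omega> in P.
        real_cond_exp P (filt P X t) (indicator {\<omega>' \<in> space P. X (Suc t) \<omega>' = e i}) \<omega>
          = (A *v X t \<omega>) $ i)"

section \<open>Uniform ergodicity\<close>

text \<open>A measure \<open>\<mu>\<close> on the finite state space is encoded as the vector with entries \<open>\<mu>({e\<^sub>i})\<close>.\<close>

definition prob_vec :: "(real ^ 'n::finite) \<Rightarrow> bool" where
  "prob_vec \<mu> \<longleftrightarrow> (\<forall>i. \<mu> $ i \<ge> 0) \<and> (\<Sum>i\<in>UNIV. \<mu> $ i) = 1"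

definition tv_norm :: "(real ^ 'n::finite) \<Rightarrow> real" where
  "tv_norm \<mu> = (1 / 2) * (\<Sum>i\<in>UNIV. \<bar>\<mu> $ i\<bar>)"

text \<open>The law of \<open>X\<^sub>t\<close> when \<open>X\<^sub>0\<close> has law \<open>\<mu>\<close>; see \<open>law_vec_markov_chain\<close> below.\<close>

definition chain_law :: "real ^ 'n ^ 'n::finite \<Rightarrow> nat \<Rightarrow> real ^ 'n \<Rightarrow> real ^ 'n" where
  "chain_law A t \<mu> = (((*v) A) ^^ t) \<mu>"

definition uniformly_ergodic :: "real ^ 'n ^ 'n::finite \<Rightarrow> bool" where
  "uniformly_ergodic A \<longleftrightarrow>
     (\<exists>\<pi> R \<rho>. prob_vec \<pi> \<and> R > 0 \<and> \<rho> > 0 \<and>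
        (\<forall>t \<mu>. prob_vec \<mu> \<longrightarrow> tv_norm (chain_law A t \<mu> - \<pi>) \<le> R * exp (- \<rho> * real t)))"

definition law_vec :: "'a measure \<Rightarrow> ('a \<Rightarrow> real ^ 'n::finite) \<Rightarrow> real ^ 'n" where
  "law_vec P x = (\<chi> i. measure P {\<omega> \<in> space P. x \<omega> = e i})"

section \<open>The martingale difference and the induced equivalence\<close>

text \<open>\<open>mart_diff A X t\<close> is \<open>M\<^sub>t\<^sub>+\<^sub>1\<close>.\<close>

definition mart_diff ::
  "real ^ 'n ^ 'n::finite \<Rightarrow> (nat \<Rightarrow> 'a \<Rightarrow> real ^ 'n) \<Rightarrow> nat \<Rightarrow> 'a \<Rightarrow> real ^ 'n" where
  "mart_diff A X t \<omega> = X (Suc t) \<omega> - A *v X t \<omega>"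

definition M_seminorm ::
  "'a measure \<Rightarrow> real ^ 'n ^ 'n::finite \<Rightarrow> (nat \<Rightarrow> 'a \<Rightarrow> real ^ 'n) \<Rightarrow> nat \<Rightarrow> ('a \<Rightarrow> real ^ 'n) \<Rightarrow> 'a \<Rightarrow> real"
  where
  "M_seminorm P A X t z \<omega> =
     sqrt (real_cond_exp P (filt P X t) (\<lambda>\<omega>'. (z \<omega>' \<bullet> mart_diff A X t \<omega>')\<^sup>2) \<omega>)"

definition M_equiv ::
  "'a measure \<Rightarrow> real ^ 'n ^ 'n::finite \<Rightarrow> (nat \<Rightarrow> 'a \<Rightarrow> real ^ 'n) \<Rightarrow>
   (nat \<Rightarrow> 'a \<Rightarrow> real ^ 'n) \<Rightarrow> (nat \<Rightarrow> 'a \<Rightarrow> real ^ 'n) \<Rightarrow> bool" where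
  "M_equiv P A X Z Z' \<longleftrightarrow>
     (\<forall>t. AE \<omega> in P. M_seminorm P A X t (\<lambda>\<omega>'. Z t \<omega>' - Z' t \<omega>') \<omega> = 0)"

definition indistinguishable :: "'a measure \<Rightarrow> (nat \<Rightarrow> 'a \<Rightarrow> 'b) \<Rightarrow> (nat \<Rightarrow> 'a \<Rightarrow> 'b) \<Rightarrow> bool" where
  "indistinguishable P Y Y' \<longleftrightarrow> (AE \<omega> in P. \<forall>t. Y t \<omega> = Y' t \<omega>)"

definition uniformly_bounded :: "'a measure \<Rightarrow> (nat \<Rightarrow> 'a \<Rightarrow> real) \<Rightarrow> bool" where
  "uniformly_bounded P Y \<longleftrightarrow> (\<exists>C. AE \<omega> in P. \<forall>t. \<bar>Y t \<omega>\<bar> \<le> C)"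

section \<open>Balanced drivers\<close>

text \<open>Division with the convention \<open>0/0 = 1\<close>. For \<open>a \<noteq> 0\<close> the quotient \<open>a / 0\<close> is \<open>0\<close> in HOL, which
  lies outside \<open>[\<gamma>, 1/\<gamma>]\<close> for \<open>\<gamma> > 0\<close>, as the usual value \<open>\<plusminus>\<infinity>\<close> would.\<close>

definition ratio :: "real \<Rightarrow> real \<Rightarrow> real" where
  "ratio a b = (if a = 0 \<and> b = 0 then 1 else a / b)"

definition adapted_driver ::
  "'a measure \<Rightarrow> (nat \<Rightarrow> 'a \<Rightarrow> real ^ 'n::finite) \<Rightarrow> ('a \<Rightarrow> nat \<Rightarrow> real ^ 'n \<Rightarrow> real) \<Rightarrow> bool" where
  "adapted_driver P X g \<longleftrightarrow>
     (\<forall>t. (\<lambda>(\<omega>, z). g \<omega> t z) \<in> borel_measurable (filt P X t \<Otimes>\<^sub>M borel))"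

definition balanced ::
  "'a measure \<Rightarrow> (nat \<Rightarrow> 'a \<Rightarrow> real ^ 'n::finite) \<Rightarrow> real ^ 'n ^ 'n \<Rightarrow> real \<Rightarrow>
   ('a \<Rightarrow> nat \<Rightarrow> real ^ 'n \<Rightarrow> real) \<Rightarrow> bool" where
  "balanced P X A \<gamma> g \<longleftrightarrow>
     adapted_driver P X g \<and>
     (\<exists>\<psi> :: 'a \<Rightarrow> nat \<Rightarrow> real ^ 'n \<Rightarrow> real ^ 'n \<Rightarrow> real ^ 'n.
        (\<forall>t. (\<lambda>(\<omega>, z, z'). \<psi> \<omega> t z z')
               \<in> borel_measurable (filt P X t \<Otimes>\<^sub>M (borel \<Otimes>\<^sub>M borel))) \<and>
        (\<forall>t z z'. AE \<omega> in P.
           g \<omega> t z - g \<omega> t z' = (z - z') \<bullet> (\<psi> \<omega> t z z' - A *v X t \<omega>) \<and>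
           (\<forall>i. ratio (\<psi> \<omega> t z z' $ i) ((A *v X t \<omega>) $ i) \<in> {\<gamma> .. 1 / \<gamma>}) \<and>
           (\<Sum>i\<in>UNIV. \<psi> \<omega> t z z' $ i) = 1))"

section \<open>Discounted and ergodic BSDEs\<close>

definition discounted_solution ::
  "'a measure \<Rightarrow> (nat \<Rightarrow> 'a \<Rightarrow> real ^ 'n::finite) \<Rightarrow> real ^ 'n ^ 'n \<Rightarrow>
   (real ^ 'n \<Rightarrow> real ^ 'n \<Rightarrow> real) \<Rightarrow> real \<Rightarrow>
   (nat \<Rightarrow> 'a \<Rightarrow> real) \<Rightarrow> (nat \<Rightarrow> 'a \<Rightarrow> real ^ 'n) \<Rightarrow> bool" where
  "discounted_solution P X A f \<alpha> Y Z \<longleftrightarrow>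
     adapted P X Y \<and> adapted P X Z \<and>
     (\<forall>t T. t < T \<longrightarrow> (AE \<omega> in P.
        Y T \<omega> = Y t \<omega> - (\<Sum>u\<in>{t..<T}. f (X u \<omega>) (Z u \<omega>) - \<alpha> * Y u \<omega>)
                        + (\<Sum>u\<in>{t..<T}. Z u \<omega> \<bullet> mart_diff A X u \<omega>)))"

definition ergodic_solution ::
  "'a measure \<Rightarrow> (nat \<Rightarrow> 'a \<Rightarrow> real ^ 'n::finite) \<Rightarrow> real ^ 'n ^ 'n \<Rightarrow>
   (real ^ 'n \<Rightarrow> real ^ 'n \<Rightarrow> real) \<Rightarrow>
   (nat \<Rightarrow> 'a \<Rightarrow> real) \<Rightarrow> (nat \<Rightarrow> 'a \<Rightarrow> real ^ 'n) \<Rightarrow> real \<Rightarrow> bool" where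
  "ergodic_solution P X A f Y Z lam \<longleftrightarrow>
     adapted P X Y \<and> adapted P X Z \<and>
     (\<forall>t T. t < T \<longrightarrow> (AE \<omega> in P.
        Y T \<omega> = Y t \<omega> - (\<Sum>u\<in>{t..<T}. f (X u \<omega>) (Z u \<omega>) - lam)
                        + (\<Sum>u\<in>{t..<T}. Z u \<omega> \<bullet> mart_diff A X u \<omega>)))"

definition represents ::
  "'a measure \<Rightarrow> (nat \<Rightarrow> 'a \<Rightarrow> real ^ 'n::finite) \<Rightarrow> (real ^ 'n \<Rightarrow> 'b) \<Rightarrow> (nat \<Rightarrow> 'a \<Rightarrow> 'b) \<Rightarrow> bool" where
  "represents P X v Y \<longleftrightarrow> (AE \<omega> in P. \<forall>t. Y t \<omega> = v (X t \<omega>))"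

definition stationary_markovian ::
  "'a measure \<Rightarrow> (nat \<Rightarrow> 'a \<Rightarrow> real ^ 'n::finite) \<Rightarrow>
   (nat \<Rightarrow> 'a \<Rightarrow> real) \<Rightarrow> (nat \<Rightarrow> 'a \<Rightarrow> real ^ 'n) \<Rightarrow> bool" where
  "stationary_markovian P X Y Z \<longleftrightarrow> (\<exists>v. represents P X v Y) \<and> (\<exists>z. represents P X z Z)"

text \<open>The vector with \<open>k\<close>-th entry \<open>v(e\<^sub>k)\<close>.\<close>

definition state_vec :: "(real ^ 'n \<Rightarrow> real) \<Rightarrow> real ^ 'n::finite" where
  "state_vec v = (\<chi> k. v (e k))"

text \<open>\<open>v\<close> represents a bounded solution of the \<open>\<alpha>\<close>-discounted equation; that solution is unique up
  to indistinguishability of \<open>Y\<close> and \<open>M_equiv\<close> of \<open>Z\<close>.\<close>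

definition discounted_value ::
  "'a measure \<Rightarrow> (nat \<Rightarrow> 'a \<Rightarrow> real ^ 'n::finite) \<Rightarrow> real ^ 'n ^ 'n \<Rightarrow>
   (real ^ 'n \<Rightarrow> real ^ 'n \<Rightarrow> real) \<Rightarrow> real \<Rightarrow> (real ^ 'n \<Rightarrow> real) \<Rightarrow> bool" where
  "discounted_value P X A f \<alpha> v \<longleftrightarrow>
     (\<exists>Y Z. discounted_solution P X A f \<alpha> Y Z \<and> uniformly_bounded P Y \<and>
        represents P X v Y \<and> M_equiv P A X Z (\<lambda>t \<omega>. state_vec v))"

definition vanishing_discount_limit ::
  "(real \<Rightarrow> real ^ 'n::finite \<Rightarrow> real) \<Rightarrow> real ^ 'n \<Rightarrow> (nat \<Rightarrow> real) \<Rightarrow>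
   real \<Rightarrow> (real ^ 'n \<Rightarrow> real) \<Rightarrow> bool" where
  "vanishing_discount_limit v\<alpha> x0 \<alpha> lam v \<longleftrightarrow>
     (\<forall>n. \<alpha> n > 0) \<and> decseq \<alpha> \<and> \<alpha> \<longlonglongrightarrow> 0 \<and>
     (\<forall>x\<in>states. (\<lambda>n. v\<alpha> (\<alpha> n) x - v\<alpha> (\<alpha> n) x0) \<longlonglongrightarrow> v x \<and>
                 (\<lambda>n. \<alpha> n * v\<alpha> (\<alpha> n) x) \<longlonglongrightarrow> lam)"

text \<open>The processes \<open>(v(X\<^sub>t))\<close> and \<open>(v\<^sup>\<alpha>(X\<^sub>t))\<close> carry no information about \<open>v(x)\<close> and \<open>v\<^sup>\<alpha>(x)\<close> for a
  state \<open>x\<close> that the chain, with its given initial law, almost surely never visits.\<close>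

definition visited :: "'a measure \<Rightarrow> (nat \<Rightarrow> 'a \<Rightarrow> real ^ 'n::finite) \<Rightarrow> real ^ 'n \<Rightarrow> bool" where
  "visited P X x \<longleftrightarrow> (\<exists>t. measure P {\<omega> \<in> space P. X t \<omega> = x} > 0)"

section \<open>The law of the chain\<close>

lemma subalgebra_filt:
  assumes "sets P = sigma_sets (space P) (\<Union>t. sets (filt P X t))"
  shows "subalgebra P (filt P X t)"
proof -
  have "space (filt P X t) = space P"
    by (simp add: filt_def space_restr_to_subalg)
  moreover have "sets (filt P X t) \<subseteq> sets P"
    unfolding assms by (rule subsetI, rule sigma_sets.Basic) blast
  ultimately show ?thesis by (simp add: subalgebra_def)
qed

lemma law_vec_markov_chain:
  assumes "prob_space P"
    and F: "sets P = sigma_sets (space P) (\<Union>t. sets (filt P X t))"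
    and chain: "markov_chain P X A"
  shows "law_vec P (X t) = chain_law A t (law_vec P (X 0))"
proof (induction t)
  case 0
  then show ?case by (simp add: chain_law_def)
next
  case (Suc t)
  interpret prob_space P by fact
  interpret S: finite_measure_subalgebra P "filt P X t"
    by unfold_locales (rule subalgebra_filt[OF F])
  have [measurable]: "X s \<in> borel_measurable P" for s
    using chain by (simp add: markov_chain_def)
  have val: "X s \<omega> \<in> states" if "\<omega> \<in> space P" for s \<omega>
    using chain that by (simp add: markov_chain_def)
  have comp: "X t \<omega> $ j = indicator {\<omega> \<in> space P. X t \<omega> = e j} \<omega>" if "\<omega> \<in> space P" for \<omega> j
    using val[OF that, of t] that
    by (auto simp: states_def axis_def vec_eq_iff indicator_def)
  have "measure P {\<omega> \<in> space P. X (Suc t) \<omega> = e i}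
          = (\<Sum>j\<in>UNIV. A $ i $ j * measure P {\<omega> \<in> space P. X t \<omega> = e j})" for i
  proof -
    let ?I = "\<lambda>s j. indicator {\<omega> \<in> space P. X s \<omega> = e j} :: 'a \<Rightarrow> real"
    have int: "integrable P (?I s j)" for s j
      by (rule integrable_real_indicator) (auto simp: emeasure_eq_measure)
    have "measure P {\<omega> \<in> space P. X (Suc t) \<omega> = e i} = (\<integral>\<omega>. ?I (Suc t) i \<omega> \<partial>P)"
      by simp
    also have "\<dots> = (\<integral>\<omega>. real_cond_exp P (filt P X t) (?I (Suc t) i) \<omega> \<partial>P)"
      using S.real_cond_exp_int(2)[OF int] by simp
    also have "\<dots> = (\<integral>\<omega>. (\<Sum>j\<in>UNIV. A $ i $ j * ?I t j \<omega>) \<partial>P)"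
    proof (rule integral_cong_AE)
      have "AE \<omega> in P. real_cond_exp P (filt P X t) (?I (Suc t) i) \<omega> = (A *v X t \<omega>) $ i"
        using chain by (simp add: markov_chain_def)
      then show "AE \<omega> in P. real_cond_exp P (filt P X t) (?I (Suc t) i) \<omega>
                   = (\<Sum>j\<in>UNIV. A $ i $ j * ?I t j \<omega>)"
        using AE_space by eventually_elim (simp add: matrix_vector_mult_def comp)
    qed measurable
    also have "\<dots> = (\<Sum>j\<in>UNIV. A $ i $ j * measure P {\<omega> \<in> space P. X t \<omega> = e j})"
      by (subst Bochner_Integration.integral_sum)
        (use int in \<open>auto intro!: sum.cong simp del: integral_indicator sum_mult_indicator\<close>)
    finally show ?thesis .
  qed
  then have "law_vec P (X (Suc t)) = A *v law_vec P (X t)"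
    by (simp add: law_vec_def matrix_vector_mult_def vec_eq_iff)
  then show ?case
    using Suc by (simp add: chain_law_def)
qed

end

theory Submission
  imports Defs
begin

text \<open>Averaging a Markovian equation over the next states turns it into a Poisson equation
  \<open>v\<^sub>j + r\<^sub>j = a\<^sub>j \<bullet> v + f\<^sub>j(v)\<close> on the states \<open>j\<close> that the chain visits, \<open>a\<^sub>j\<close> being column \<open>j\<close>
  of \<open>A\<close>. The \<open>\<gamma>\<close>-balance writes \<open>f\<^sub>j(z) - f\<^sub>j(z') = (z - z') \<bullet> (p - a\<^sub>j)\<close> with a law \<open>p \<ge> \<gamma> a\<^sub>j\<close>, so
  differences of solutions are harmonic for a kernel that dominates \<open>\<gamma> A\<close>. Uniform ergodicity gives
  a Doeblin minorization of a power of \<open>A\<close>, hence of that kernel, and with it an oscillation bound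
  that is uniform in the discount and forces harmonic functions to be constant.

  Two arbitrary bounded solutions are compared without a change of measure: if
  \<open>Y'\<^sub>t\<^sub>+\<^sub>1 - Y\<^sub>t\<^sub>+\<^sub>1 \<le> c\<close> almost surely, averaging over the next states with weights \<open>p\<close> gives
  \<open>Y'\<^sub>t - Y\<^sub>t \<le> c - (\<lambda>' - \<lambda>)\<close>, and iterating this contradicts boundedness unless \<open>\<lambda>' \<le> \<lambda>\<close>.\<close>

section \<open>Oscillation bounds for balanced kernels\<close>

lemma column_stochastic_mult:
  assumes "column_stochastic A" and "prob_vec \<mu>"
  shows "prob_vec (A *v \<mu>)"
proof -
  have "(\<Sum>i\<in>UNIV. \<Sum>j\<in>UNIV. A $ i $ j * \<mu> $ j) = (\<Sum>j\<in>UNIV. (\<Sum>i\<in>UNIV. A $ i $ j) * \<mu> $ j)"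
    by (subst sum.swap) (simp add: sum_distrib_right)
  with assms show ?thesis
    by (auto simp: prob_vec_def column_stochastic_def matrix_vector_mult_def intro!: sum_nonneg)
qed

lemma prob_vec_axis: "prob_vec (e j)"
  by (auto simp: prob_vec_def axis_def)

lemma mult_axis_nth: "(A *v e j) $ i = A $ i $ j"
  by (simp add: matrix_vector_mult_basis column_def)

lemma inner_vec_sum: "(z :: real ^ 'n::finite) \<bullet> p = (\<Sum>i\<in>UNIV. p $ i * z $ i)"
  by (simp add: inner_vec_def mult.commute)

text \<open>Column \<open>j\<close> of \<open>A\<close> is the law of the next state from
  \<open>j\<close>, so for a stochastic \<open>A\<close> the chain cannot leave \<open>W\<close>.
  Estimates are made on such a set because the balance condition is only known at visited
  states.\<close>

definition closed_under :: "real ^ 'n ^ 'n::finite \<Rightarrow> 'n set \<Rightarrow> bool" where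
  "closed_under A W \<longleftrightarrow> (\<forall>j\<in>W. \<forall>i. A $ i $ j > 0 \<longrightarrow> i \<in> W)"

text \<open>The values that the \<open>\<gamma>\<close>-balance conditions allow for \<open>\<psi>\<close> on \<open>{X\<^sub>t = e\<^sub>j}\<close>, apart from the
  upper bound \<open>1 / \<gamma>\<close> on the density.\<close>

definition balanced_law :: "real ^ 'n ^ 'n::finite \<Rightarrow> real \<Rightarrow> 'n \<Rightarrow> (real ^ 'n) set" where
  "balanced_law A \<gamma> j = {p. prob_vec p \<and> (\<forall>i. \<gamma> * A $ i $ j \<le> p $ i) \<and> (\<forall>i. A $ i $ j = 0 \<longrightarrow> p $ i = 0)}"

text \<open>The decay in total variation is uniform in the initial law, so one time \<open>m\<close>
  serves every starting state; \<open>k\<close> is any state charged by the limit law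
  \<open>\<pi>\<close>.\<close>

lemma doeblin_condition:
  fixes A :: "real ^ 'n ^ 'n::finite"
  assumes "uniformly_ergodic A"
  obtains \<delta> m k where "\<delta> > 0" and "\<forall>j. \<delta> \<le> chain_law A m (e j) $ k"
proof -
  obtain \<pi> R \<rho> where \<pi>: "prob_vec \<pi>" and R: "R > 0" "\<rho> > 0"
    and tv: "\<And>t \<mu>. prob_vec \<mu> \<Longrightarrow> tv_norm (chain_law A t \<mu> - \<pi>) \<le> R * exp (- \<rho> * real t)"
    using assms unfolding uniformly_ergodic_def by blast
  have "\<exists>k. \<pi> $ k > 0"
  proof (rule ccontr)
    assume "\<not> ?thesis"
    then have "\<pi> $ k = 0" for k
      using \<pi> by (metis prob_vec_def order_le_less)
    then show False
      using \<pi> by (simp add: prob_vec_def)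
  qed
  then obtain k where k: "\<pi> $ k > 0" by blast
  have "(\<lambda>t. R * exp (- \<rho> * real t)) \<longlonglongrightarrow> 0"
    using R by real_asymp
  \<comment> \<open>\<open>tv_norm\<close> carries the factor 1/2, so a distance below a quarter of
    \<open>\<pi> $ k\<close> moves each entry by at most half of it.\<close>
  then have "eventually (\<lambda>t. R * exp (- \<rho> * real t) < \<pi> $ k / 4) sequentially"
    by (rule order_tendstoD) (use k in simp)
  then obtain m where m: "R * exp (- \<rho> * real m) < \<pi> $ k / 4"
    by (auto simp: eventually_sequentially)
  have "\<pi> $ k / 2 \<le> chain_law A m (e j) $ k" for j
  proof -
    let ?d = "chain_law A m (e j) - \<pi>"
    have "\<bar>?d $ k\<bar> \<le> (\<Sum>i\<in>UNIV. \<bar>?d $ i\<bar>)"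
      by (rule member_le_sum) auto
    also have "\<dots> = 2 * tv_norm ?d"
      by (simp add: tv_norm_def)
    also have "\<dots> \<le> \<pi> $ k / 2"
      using tv[OF prob_vec_axis, of m j] m by linarith
    finally have "\<bar>?d $ k\<bar> \<le> \<pi> $ k / 2" .
    then show ?thesis
      unfolding vector_minus_component by linarith
  qed
  then show ?thesis
    using k by (intro that[of "\<pi> $ k / 2" m k]) auto
qed

text \<open>Splits off the first step rather than the last, so that the inductions below can
  generalize over the initial law.\<close>

lemma chain_law_Suc: "chain_law A (Suc m) \<mu> = chain_law A m (A *v \<mu>)"
  by (simp add: chain_law_def funpow_swap1)

lemma closed_under_mult:
  assumes "column_stochastic A" and "closed_under A W" and "\<And>i. i \<notin> W \<Longrightarrow> \<mu> $ i = 0"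
    and "i \<notin> W"
  shows "(A *v \<mu>) $ i = 0"
proof -
  have "A $ i $ j * \<mu> $ j = 0" for j
    using assms unfolding closed_under_def column_stochastic_def
    by (metis mult_zero_left mult_zero_right order_le_less)
  then show ?thesis
    unfolding matrix_vector_mult_def vec_lambda_beta by (intro sum.neutral) blast
qed

lemma closed_under_chain_law:
  assumes "column_stochastic A" and "closed_under A W"
    and "prob_vec \<mu>" and "\<And>i. i \<notin> W \<Longrightarrow> \<mu> $ i = 0"
  shows "prob_vec (chain_law A m \<mu>) \<and> (\<forall>i. i \<notin> W \<longrightarrow> chain_law A m \<mu> $ i = 0)"
  using assms(3,4)
proof (induction m arbitrary: \<mu>)
  case 0
  then show ?case by (simp add: chain_law_def)
next
  case (Suc m)
  show ?case
    unfolding chain_law_Suc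
    by (rule Suc.IH)
      (use Suc.prems assms(1,2) in \<open>auto intro: column_stochastic_mult closed_under_mult\<close>)
qed

text \<open>Averaging the pointwise inequality against \<open>\<mu>\<close> gives one step along the
  chain. Each step multiplies the average by \<open>\<gamma>\<close> and costs at most
  \<open>c\<close>, since \<open>\<gamma> \<le> 1\<close> does not enlarge the defects of later
  steps.\<close>

lemma superharmonic_iterate:
  fixes A :: "real ^ 'n ^ 'n::finite"
  assumes A: "column_stochastic A" "closed_under A W" and \<gamma>: "0 \<le> \<gamma>" "\<gamma> \<le> 1" and "c \<ge> 0"
    and u: "\<And>j. j \<in> W \<Longrightarrow> \<gamma> * (u \<bullet> (A *v e j)) - c \<le> u $ j"
    and "prob_vec \<mu>" "\<And>i. i \<notin> W \<Longrightarrow> \<mu> $ i = 0"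
  shows "\<gamma> ^ m * (u \<bullet> chain_law A m \<mu>) - real m * c \<le> u \<bullet> \<mu>"
  using assms(7,8)
proof (induction m arbitrary: \<mu>)
  case 0
  then show ?case by (simp add: chain_law_def)
next
  case (Suc m)
  \<comment> \<open>As a mixture of columns, the new law lets the hypothesis on \<open>u\<close> be
    averaged; states outside \<open>W\<close> have weight zero.\<close>
  have "A *v \<mu> = (\<Sum>j\<in>UNIV. \<mu> $ j *\<^sub>R (A *v e j))"
    by (simp add: vec_eq_iff mult_axis_nth sum_component vector_scaleR_component)
      (simp add: matrix_vector_mult_def mult.commute)
  then have "\<gamma> * (u \<bullet> (A *v \<mu>)) - c = (\<Sum>j\<in>UNIV. \<mu> $ j * (\<gamma> * (u \<bullet> (A *v e j)) - c))"
    using Suc.prems(1)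
    by (simp add: inner_sum_right right_diff_distrib sum_subtractf sum_distrib_left prob_vec_def
        flip: sum_distrib_right) (simp add: mult.left_commute)
  also have "\<dots> \<le> (\<Sum>j\<in>UNIV. \<mu> $ j * u $ j)"
  proof (rule sum_mono)
    fix j
    show "\<mu> $ j * (\<gamma> * (u \<bullet> (A *v e j)) - c) \<le> \<mu> $ j * u $ j"
      using Suc.prems u[of j] by (cases "j \<in> W") (auto simp: prob_vec_def intro!: mult_left_mono)
  qed
  finally have 1: "\<gamma> * (u \<bullet> (A *v \<mu>)) - c \<le> u \<bullet> \<mu>"
    by (simp add: inner_vec_sum)
  have "\<gamma> ^ m * (u \<bullet> chain_law A m (A *v \<mu>)) - real m * c \<le> u \<bullet> (A *v \<mu>)"
    by (rule Suc.IH) (use Suc.prems A in \<open>auto intro: column_stochastic_mult closed_under_mult\<close>)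
  then have "\<gamma> * (\<gamma> ^ m * (u \<bullet> chain_law A m (A *v \<mu>)) - real m * c) \<le> \<gamma> * (u \<bullet> (A *v \<mu>))"
    using \<gamma> by (intro mult_left_mono)
  moreover have "\<gamma> * (real m * c) \<le> real m * c"
    using \<gamma> \<open>c \<ge> 0\<close> by (simp add: mult_left_le_one_le)
  ultimately show ?case
    using 1 by (simp add: chain_law_Suc algebra_simps)
qed

text \<open>Shifted by its minimum over \<open>W\<close>, \<open>w\<close> becomes a function
  \<open>u\<close> that is nonnegative there, and domination of \<open>\<gamma> * A $ i $ j\<close>
  by \<open>p $ i\<close> replaces the varying laws \<open>p\<close> by one matrix. Iterating
  \<open>m\<close> times from the minimizer, where \<open>u\<close> is zero, and keeping only the
  Doeblin state \<open>k\<close> gives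
  \<open>\<gamma> ^ m * (\<delta> * u $ k) \<le> real m * c\<close>.\<close>

lemma superharmonic_bound:
  fixes A :: "real ^ 'n ^ 'n::finite"
  assumes A: "column_stochastic A" "closed_under A W" and \<gamma>: "0 < \<gamma>" "\<gamma> \<le> 1" and "c \<ge> 0"
    and "\<delta> > 0" and law: "\<And>j. \<delta> \<le> chain_law A m (e j) $ k"
    and w: "\<And>j. j \<in> W \<Longrightarrow> \<exists>p\<in>balanced_law A \<gamma> j. w \<bullet> p - c \<le> w $ j"
    and "j \<in> W"
  shows "k \<in> W" and "w $ k - w $ j \<le> real m * c / (\<gamma> ^ m * \<delta>)"
proof -
  have fin: "finite ((\<lambda>i. w $ i) ` W)" and ne: "(\<lambda>i. w $ i) ` W \<noteq> {}"
    using \<open>j \<in> W\<close> by auto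
  obtain j0 where j0: "j0 \<in> W" and w_j0: "w $ j0 = Min ((\<lambda>i. w $ i) ` W)"
    using Min_in[OF fin ne] by auto
  have w_min: "w $ j0 \<le> w $ i" if "i \<in> W" for i
    unfolding w_j0 using that by (intro Min_le) auto
  define u :: "real ^ 'n" where "u = (\<chi> i. w $ i - w $ j0)"
  have u_nonneg: "u $ i \<ge> 0" if "i \<in> W" for i
    using w_min[OF that] by (simp add: u_def)
  have u_inner: "u \<bullet> p = w \<bullet> p - w $ j0" if "prob_vec p" for p
    using that
    by (simp add: u_def inner_vec_sum prob_vec_def right_diff_distrib sum_subtractf flip: sum_distrib_right)
  have u_super: "\<gamma> * (u \<bullet> (A *v e i)) - c \<le> u $ i" if i: "i \<in> W" for i
  proof -
    obtain p where p: "p \<in> balanced_law A \<gamma> i" and "w \<bullet> p - c \<le> w $ i"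
      using w[OF i] by blast
    then have "u \<bullet> p - c \<le> u $ i"
      using u_inner[of p] by (simp add: balanced_law_def u_def)
    \<comment> \<open>On the support of the column the index lies in \<open>W\<close>, where
      \<open>u\<close> is nonnegative; off the support \<open>p\<close> vanishes too, so the sign of
      \<open>u\<close> outside \<open>W\<close> does not matter.\<close>
    moreover have "\<gamma> * (u \<bullet> (A *v e i)) \<le> u \<bullet> p"
      unfolding inner_vec_sum sum_distrib_left
    proof (rule sum_mono)
      fix l
      show "\<gamma> * ((A *v e i) $ l * u $ l) \<le> p $ l * u $ l"
      proof (cases "A $ l $ i = 0")
        case True
        with p show ?thesis by (simp add: mult_axis_nth balanced_law_def)
      next
        case False
        then have "l \<in> W"
          using A i by (metis closed_under_def column_stochastic_def order_le_less)
        then show ?thesis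
          using p u_nonneg[of l] mult_right_mono[of "\<gamma> * A $ l $ i" "p $ l" "u $ l"]
          by (simp add: mult_axis_nth balanced_law_def mult.assoc)
      qed
    qed
    ultimately show ?thesis by linarith
  qed
  have supp: "prob_vec (chain_law A m (e j0)) \<and> (\<forall>i. i \<notin> W \<longrightarrow> chain_law A m (e j0) $ i = 0)"
    by (rule closed_under_chain_law[OF A prob_vec_axis]) (use j0 in \<open>auto simp: axis_def\<close>)
  \<comment> \<open>The chain started at \<open>j0\<close> stays in \<open>W\<close> and yet charges
    \<open>k\<close>.\<close>
  then show k: "k \<in> W"
    using law[of j0] \<open>\<delta> > 0\<close> by force
  have "\<gamma> ^ m * (u \<bullet> chain_law A m (e j0)) - real m * c \<le> u \<bullet> e j0"
    by (rule superharmonic_iterate[OF A _ _ \<open>c \<ge> 0\<close> u_super prob_vec_axis])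
      (use \<gamma> j0 in \<open>auto simp: axis_def\<close>)
  moreover have "u \<bullet> e j0 = 0"
    by (simp add: inner_axis u_def)
  moreover have "\<delta> * u $ k \<le> chain_law A m (e j0) $ k * u $ k"
    using law u_nonneg[OF k] by (intro mult_right_mono)
  moreover have "chain_law A m (e j0) $ k * u $ k \<le> u \<bullet> chain_law A m (e j0)"
    unfolding inner_vec_sum
  proof (rule member_le_sum)
    fix i
    show "0 \<le> chain_law A m (e j0) $ i * u $ i"
      using supp u_nonneg[of i] by (cases "i \<in> W") (auto simp: prob_vec_def)
  qed auto
  moreover have "0 \<le> \<gamma> ^ m"
    using \<gamma> by simp
  ultimately have "\<gamma> ^ m * (\<delta> * u $ k) \<le> real m * c"
    using mult_left_mono[of "\<delta> * u $ k" "u \<bullet> chain_law A m (e j0)" "\<gamma> ^ m"] by linarith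
  then have "u $ k \<le> real m * c / (\<gamma> ^ m * \<delta>)"
    using \<gamma> \<open>\<delta> > 0\<close> by (simp add: field_simps)
  then show "w $ k - w $ j \<le> real m * c / (\<gamma> ^ m * \<delta>)"
    using w_min[OF \<open>j \<in> W\<close>] by (simp add: u_def)
qed

text \<open>The bound depends on \<open>w\<close> only through the defect \<open>c\<close>; for \<open>c = 0\<close> it is a Liouville theorem.\<close>

lemma oscillation_bound:
  fixes A :: "real ^ 'n ^ 'n::finite"
  assumes "column_stochastic A" "uniformly_ergodic A" "closed_under A W" and "0 < \<gamma>" "\<gamma> \<le> 1"
  obtains K where "\<And>w c i j. \<lbrakk>\<And>j. j \<in> W \<Longrightarrow> \<exists>p\<in>balanced_law A \<gamma> j. \<bar>w $ j - w \<bullet> p\<bar> \<le> c;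
    c \<ge> 0; i \<in> W; j \<in> W\<rbrakk> \<Longrightarrow> \<bar>w $ i - w $ j\<bar> \<le> K * c"
proof -
  obtain \<delta> m k where \<delta>: "\<delta> > 0" and "\<forall>j. \<delta> \<le> chain_law A m (e j) $ k"
    using doeblin_condition[OF assms(2)] by metis
  then have law: "\<delta> \<le> chain_law A m (e j) $ k" for j
    by blast
  let ?K = "real m / (\<gamma> ^ m * \<delta>)"
  have "\<bar>w $ i - w $ j\<bar> \<le> (2 * ?K) * c"
    if w: "\<And>j. j \<in> W \<Longrightarrow> \<exists>p\<in>balanced_law A \<gamma> j. \<bar>w $ j - w \<bullet> p\<bar> \<le> c"
      and c: "c \<ge> 0" and ij: "i \<in> W" "j \<in> W" for w c i j
  proof -
    \<comment> \<open>Applied to \<open>w\<close> and to \<open>- w\<close>, the one-sided bound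
      places \<open>w $ i\<close> and \<open>w $ j\<close> within \<open>?K * c\<close> of
      \<open>w $ k\<close>, hence the factor 2.\<close>
    have "\<exists>p\<in>balanced_law A \<gamma> l. w \<bullet> p - c \<le> w $ l" if "l \<in> W" for l
      by (rule bexE[OF w[OF that]], rule bexI[rotated], assumption) (simp only: abs_le_iff inner_minus_left vector_uminus_component, linarith)
    note lo = superharmonic_bound(2)[OF assms(1,3-5) c \<delta> law this]
    have "\<exists>p\<in>balanced_law A \<gamma> l. (- w) \<bullet> p - c \<le> (- w) $ l" if "l \<in> W" for l
      by (rule bexE[OF w[OF that]], rule bexI[rotated], assumption) (simp only: abs_le_iff inner_minus_left vector_uminus_component, linarith)
    note hi = superharmonic_bound(2)[OF assms(1,3-5) c \<delta> law this]
    have "(2 * ?K) * c = 2 * (real m * c / (\<gamma> ^ m * \<delta>))"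
      by simp
    then show ?thesis
      using lo[OF _ ij(1)] lo[OF _ ij(2)] hi[OF _ ij(1)] hi[OF _ ij(2)]
      unfolding vector_uminus_component abs_le_iff by linarith
  qed
  then show ?thesis
    by (rule that)
qed

text \<open>With \<open>a\<close> the current column, this writes a driver difference as an average
  of the possible martingale increments \<open>z \<bullet> (e i - a)\<close>.\<close>

lemma inner_prob_vec_diff:
  assumes "prob_vec p"
  shows "z \<bullet> (p - a) = (\<Sum>i\<in>UNIV. p $ i * (z \<bullet> (e i - a)))"
proof -
  have "(\<Sum>i\<in>UNIV. p $ i * (z \<bullet> (e i - a))) = (\<Sum>i\<in>UNIV. p $ i * z $ i) - (\<Sum>i\<in>UNIV. p $ i) * (z \<bullet> a)"
    by (simp add: inner_diff_right inner_axis right_diff_distrib sum_subtractf sum_distrib_right)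
  then show ?thesis
    using assms by (simp add: prob_vec_def inner_diff_right inner_vec_sum[of z p])
qed

lemma prob_vec_bound:
  assumes "prob_vec p" and "\<And>i. \<bar>z $ i\<bar> \<le> C"
  shows "\<bar>z \<bullet> p\<bar> \<le> C"
proof -
  have "\<bar>z \<bullet> p\<bar> \<le> (\<Sum>i\<in>UNIV. \<bar>p $ i * z $ i\<bar>)"
    unfolding inner_vec_sum by (rule sum_abs)
  also have "\<dots> \<le> (\<Sum>i\<in>UNIV. p $ i * C)"
    using assms by (intro sum_mono) (auto simp: abs_mult prob_vec_def intro!: mult_left_mono)
  also have "\<dots> = C"
    using assms(1) by (simp add: prob_vec_def flip: sum_distrib_right)
  finally show ?thesis .
qed

lemma state_vec_nth: "state_vec v $ i = v (e i)"
  by (simp add: state_vec_def)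

lemma state_vec_inner: "state_vec v \<bullet> e i = v (e i)"
  by (simp add: state_vec_def inner_axis)

lemma borel_measurable_vec_nth [measurable (raw)]:
  fixes g :: "'a \<Rightarrow> real ^ 'n::finite"
  assumes "g \<in> borel_measurable M"
  shows "(\<lambda>\<omega>. g \<omega> $ i) \<in> borel_measurable M"
  by (rule measurable_compose[OF assms]) (intro borel_measurable_continuous_onI continuous_intros)

lemma bounded_range_vec:
  fixes z :: "nat \<Rightarrow> real ^ 'n::finite"
  assumes "\<And>n i. \<bar>z n $ i\<bar> \<le> C"
  shows "bounded (range z)"
proof -
  have "norm (z n) \<le> (\<Sum>i\<in>(UNIV :: 'n set). C)" for n
    by (rule order_trans[OF norm_le_l1_cart sum_mono]) (rule assms)
  then show ?thesis
    by (auto simp: bounded_iff)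
qed

lemma axis_one_eq_iff: "e i = e j \<longleftrightarrow> i = j"
  by (simp add: axis_eq_axis)

section \<open>Passing from the process to the visited states\<close>

locale balanced_chain = prob_space P for P :: "'a measure" +
  fixes X :: "nat \<Rightarrow> 'a \<Rightarrow> real ^ 'n::finite" and A :: "real ^ 'n ^ 'n" and \<gamma> :: real
    and f :: "real ^ 'n \<Rightarrow> real ^ 'n \<Rightarrow> real"
  assumes filtration: "sets P = sigma_sets (space P) (\<Union>t. sets (filt P X t))"
    and chain: "markov_chain P X A"
    and ergodic: "uniformly_ergodic A"
    and gamma: "0 < \<gamma>" "\<gamma> < 1"
    and driver: "balanced P X A \<gamma> (\<lambda>\<omega> t z. f (X t \<omega>) z)"
begin

definition W :: "'n set" where
  "W = {j. visited P X (e j)}"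

lemma stochastic: "column_stochastic A"
  using chain by (simp add: markov_chain_def)

lemma filt_subalgebra: "finite_measure_subalgebra P (filt P X t)"
  by unfold_locales (rule subalgebra_filt[OF filtration])

lemma space_filt [simp]: "space (filt P X t) = space P"
  by (simp add: filt_def space_restr_to_subalg)

lemma measurable_filt_P: "g \<in> borel_measurable (filt P X t) \<Longrightarrow> g \<in> borel_measurable P"
  using subalgebra_filt[OF filtration] by (rule measurable_from_subalg)

lemma X_measurable [measurable]: "X t \<in> borel_measurable P"
  using chain by (simp add: markov_chain_def)

lemma X_states: "\<omega> \<in> space P \<Longrightarrow> \<exists>j. X t \<omega> = e j"
  using chain unfolding markov_chain_def states_def by blast

lemma X_adapted [measurable]: "X t \<in> borel_measurable (filt P X t)"
proof -
  let ?G = "{X s -` B \<inter> space P |s B. s \<le> t \<and> B \<in> sets borel}"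
  have sub: "?G \<subseteq> Pow (space P)" by auto
  have "?G \<subseteq> sets P"
    using measurable_sets[OF X_measurable] by auto
  then have "sigma_sets (space P) ?G \<subseteq> sets P"
    by (rule sets.sigma_sets_subset)
  then have "subalgebra P (raw_filt P X t)"
    by (simp add: subalgebra_def raw_filt_def space_measure_of[OF sub] sets_measure_of[OF sub])
  moreover have "X t \<in> borel_measurable (raw_filt P X t)"
    unfolding raw_filt_def
    by (rule measurableI) (use sub in \<open>auto simp: space_measure_of sets_measure_of intro!: sigma_sets.Basic\<close>)
  ultimately show ?thesis
    unfolding filt_def by (intro measurable_completion measurable_in_subalg)
qed

text \<open>On the basis vectors an arbitrary \<open>g\<close> agrees with a linear function, which
  is measurable.\<close>

lemma state_function_measurable [measurable]:
  fixes g :: "real ^ 'n \<Rightarrow> real"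
  shows "(\<lambda>\<omega>. g (X t \<omega>)) \<in> borel_measurable (filt P X t)"
proof -
  have "(\<lambda>\<omega>. \<Sum>j\<in>UNIV. g (e j) * (X t \<omega> $ j)) \<in> borel_measurable (filt P X t)"
    by measurable
  moreover have "(\<Sum>j\<in>UNIV. g (e j) * (X t \<omega> $ j)) = g (X t \<omega>)" if \<omega>: "\<omega> \<in> space P" for \<omega>
  proof -
    obtain i where "X t \<omega> = e i" using X_states[OF \<omega>] by blast
    then show ?thesis by (simp add: axis_def if_distrib cong: if_cong)
  qed
  ultimately show ?thesis
    by (subst (asm) measurable_cong) auto
qed

lemma driver_measurable [measurable]:
  assumes Z: "Z \<in> borel_measurable (filt P X t)"
  shows "(\<lambda>\<omega>. f (X t \<omega>) (Z \<omega>)) \<in> borel_measurable (filt P X t)"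
proof -
  define g where "g = (\<lambda>(\<omega>, z). f (X t \<omega>) z)"
  have g: "g \<in> borel_measurable (filt P X t \<Otimes>\<^sub>M borel)"
    using driver by (simp add: g_def balanced_def adapted_driver_def)
  have "(\<lambda>\<omega>. (\<omega>, Z \<omega>)) \<in> filt P X t \<rightarrow>\<^sub>M filt P X t \<Otimes>\<^sub>M borel"
    by (intro measurable_Pair measurable_ident_sets refl Z)
  from measurable_compose[OF this g] show ?thesis
    by (simp add: g_def)
qed

text \<open>Given \<open>\<F>\<^sub>t\<close>, every transition of positive probability occurs with positive conditional
  probability, so an \<open>\<F>\<^sub>t\<close>-measurable property of the actual next state holds for all possible ones.\<close>

lemma next_state_AE:
  assumes Q: "\<And>i. {\<omega> \<in> space P. Q i \<omega>} \<in> sets (filt P X t)"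
    and nxt: "AE \<omega> in P. \<forall>i. X (Suc t) \<omega> = e i \<longrightarrow> Q i \<omega>"
  shows "AE \<omega> in P. \<forall>i. (A *v X t \<omega>) $ i > 0 \<longrightarrow> Q i \<omega>"
proof -
  interpret S: finite_measure_subalgebra P "filt P X t"
    by (rule filt_subalgebra)
  have "AE \<omega> in P. (A *v X t \<omega>) $ i > 0 \<longrightarrow> Q i \<omega>" for i
  proof -
    define B where "B = space P - {\<omega> \<in> space P. Q i \<omega>}"
    let ?I = "indicator {\<omega> \<in> space P. X (Suc t) \<omega> = e i} :: 'a \<Rightarrow> real"
    have B: "B \<in> sets (filt P X t)"
      unfolding B_def using Q[of i] sets.compl_sets[of _ "filt P X t"] by fastforce
    then have [measurable]: "B \<in> sets P"
      using subalgebra_filt[OF filtration] by (auto simp: subalgebra_def)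
    have I: "integrable P ?I"
      by (rule integrable_real_indicator) (auto simp: emeasure_eq_measure)
    have nonneg: "0 \<le> indicator B \<omega> * (A *v X t \<omega>) $ i" if "\<omega> \<in> space P" for \<omega>
      using X_states[OF that, of t] stochastic
      by (auto simp: mult_axis_nth column_stochastic_def)
    have ce: "AE \<omega> in P. real_cond_exp P (filt P X t) ?I \<omega> = (A *v X t \<omega>) $ i"
      using chain by (simp add: markov_chain_def)
    have int: "integrable P (\<lambda>\<omega>. indicator B \<omega> * (A *v X t \<omega>) $ i)"
      unfolding mult.commute[of "indicator B _"]
    proof (rule integrable_real_mult_indicator)
      have "integrable P (real_cond_exp P (filt P X t) ?I)"
        by (rule S.real_cond_exp_int[OF I])
      then show "integrable P (\<lambda>\<omega>. (A *v X t \<omega>) $ i)"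
        by (rule integrable_cong_AE_imp) (use ce in \<open>auto simp: matrix_vector_mult_def\<close>)
    qed simp
    \<comment> \<open>\<open>B\<close> is the failure event of \<open>Q i\<close>. It belongs to the
      filtration at time \<open>t\<close>, so integrating over it exchanges the transition
      probability for the indicator of the transition, which almost surely does not occur on
      \<open>B\<close>.\<close>
    have "(\<integral>\<omega>. indicator B \<omega> * (A *v X t \<omega>) $ i \<partial>P) = (\<integral>\<omega>\<in>B. real_cond_exp P (filt P X t) ?I \<omega> \<partial>P)"
      unfolding set_lebesgue_integral_def
    proof (rule integral_cong_AE)
      show "AE \<omega> in P. indicator B \<omega> * (A *v X t \<omega>) $ i = indicator B \<omega> *\<^sub>R real_cond_exp P (filt P X t) ?I \<omega>"
        using ce by eventually_elim simp
    qed (auto simp: matrix_vector_mult_def)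
    also have "\<dots> = (\<integral>\<omega>\<in>B. ?I \<omega> \<partial>P)"
      by (rule S.real_cond_exp_intA[OF I B, symmetric])
    also have "\<dots> = 0"
      unfolding set_lebesgue_integral_def
    proof (rule integral_eq_zero_AE)
      show "AE \<omega> in P. indicator B \<omega> *\<^sub>R ?I \<omega> = 0"
        using nxt by eventually_elim (auto simp: B_def indicator_def)
    qed
    finally have "AE \<omega> in P. indicator B \<omega> * (A *v X t \<omega>) $ i = 0"
      using integral_nonneg_eq_0_iff_AE[OF int] nonneg by (simp add: AE_I2)
    then show ?thesis
      using AE_space by eventually_elim (auto simp: B_def indicator_def split: if_splits)
  qed
  then show ?thesis
    by (simp add: AE_all_countable)
qed

text \<open>An event of positive probability meets every almost sure property. This turns almost
  sure statements along the process into pointwise ones at a visited state.\<close>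

lemma visited_AE_witness:
  assumes "visited P X x" and "\<And>t. AE \<omega> in P. R t \<omega>"
  shows "\<exists>t. \<exists>\<omega>\<in>space P. X t \<omega> = x \<and> R t \<omega>"
proof -
  obtain t where t: "measure P {\<omega> \<in> space P. X t \<omega> = x} > 0"
    using assms(1) by (auto simp: visited_def)
  have "\<exists>\<omega>\<in>space P. X t \<omega> = x \<and> R t \<omega>"
  proof (rule ccontr)
    assume none: "\<not> ?thesis"
    have "AE \<omega> in P. X t \<omega> \<noteq> x"
      by (rule AE_mp[OF assms(2)[of t] AE_I2]) (use none in blast)
    then have "measure P {\<omega> \<in> space P. X t \<omega> = x} = 0"
      by (subst (asm) AE_iff_measurable[OF _ refl]) (auto simp: measure_def)
    with t show False by simp
  qed
  then show ?thesis by blast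
qed

lemma AE_X_visited: "AE \<omega> in P. \<forall>t. \<exists>j\<in>W. X t \<omega> = e j"
proof -
  have "AE \<omega> in P. j \<notin> W \<longrightarrow> X t \<omega> \<noteq> e j" for t j
  proof (cases "j \<in> W")
    case False
    then have "measure P {\<omega> \<in> space P. X t \<omega> = e j} = 0"
      by (simp add: W_def visited_def not_less measure_le_0_iff)
    then have "AE \<omega> in P. X t \<omega> \<noteq> e j"
      by (subst AE_iff_measurable[OF _ refl]) (auto simp: emeasure_eq_measure)
    then show ?thesis by eventually_elim simp
  qed simp
  then have "AE \<omega> in P. \<forall>t j. j \<notin> W \<longrightarrow> X t \<omega> \<noteq> e j"
    by (simp add: AE_all_countable)
  then show ?thesis
    using AE_space by eventually_elim (metis X_states)
qed

lemma W_nonempty: "W \<noteq> {}"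
proof
  assume "W = {}"
  then have "AE \<omega> in P. False"
    using AE_X_visited by simp
  then show False by simp
qed

text \<open>If \<open>i\<close> is never visited, the next state almost surely differs from
  \<open>i\<close>. This deterministic property passes through \<open>next_state_AE\<close>, so no
  visited column charges \<open>i\<close>.\<close>

lemma W_closed: "closed_under A W"
  unfolding closed_under_def
proof (intro ballI allI impI)
  fix j i assume j: "j \<in> W" and "A $ i $ j > 0"
  show "i \<in> W"
  proof (rule ccontr)
    assume i: "i \<notin> W"
    have "AE \<omega> in P. \<forall>k. (A *v X t \<omega>) $ k > 0 \<longrightarrow> k \<noteq> i" for t
    proof (rule next_state_AE)
      show "AE \<omega> in P. \<forall>k. X (Suc t) \<omega> = e k \<longrightarrow> k \<noteq> i"
        using AE_X_visited by eventually_elim (metis axis_one_eq_iff i)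
    next
      fix k
      show "{\<omega> \<in> space P. k \<noteq> i} \<in> sets (filt P X t)"
        using sets.top[of "filt P X t"] by simp
    qed
    then obtain t \<omega> where "X t \<omega> = e j" "\<forall>k. (A *v X t \<omega>) $ k > 0 \<longrightarrow> k \<noteq> i"
      using visited_AE_witness[of "e j" "\<lambda>t \<omega>. \<forall>k. (A *v X t \<omega>) $ k > 0 \<longrightarrow> k \<noteq> i"] j
      by (auto simp: W_def)
    with \<open>A $ i $ j > 0\<close> show False
      by (metis mult_axis_nth)
  qed
qed

text \<open>For fixed \<open>z\<close> and \<open>z'\<close> the balance condition is evaluated at a
  single outcome with \<open>X t \<omega> = e j\<close>; the value of \<open>\<psi>\<close> there is
  the required law.\<close>

lemma balanced_lawE:
  assumes "j \<in> W"
  obtains p where "p \<in> balanced_law A \<gamma> j"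
    and "f (e j) z - f (e j) z' = (z - z') \<bullet> (p - A *v e j)"
proof -
  let ?R = "\<lambda>\<psi> t z z' \<omega>.
      f (X t \<omega>) z - f (X t \<omega>) z' = (z - z') \<bullet> (\<psi> \<omega> t z z' - A *v X t \<omega>) \<and>
      (\<forall>i. ratio (\<psi> \<omega> t z z' $ i) ((A *v X t \<omega>) $ i) \<in> {\<gamma>..1 / \<gamma>}) \<and>
      (\<Sum>i\<in>UNIV. \<psi> \<omega> t z z' $ i) = (1::real)"
  obtain \<psi> where \<psi>: "\<And>t z z'. AE \<omega> in P. ?R \<psi> t z z' \<omega>"
    using driver unfolding balanced_def by blast
  have "visited P X (e j)"
    using assms by (simp add: W_def)
  from visited_AE_witness[OF this, of "\<lambda>t. ?R \<psi> t z z'"] \<psi>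
  obtain t \<omega> where eq: "f (e j) z - f (e j) z' = (z - z') \<bullet> (\<psi> \<omega> t z z' - A *v e j)"
    and ratio: "\<And>i. ratio (\<psi> \<omega> t z z' $ i) (A $ i $ j) \<in> {\<gamma>..1 / \<gamma>}"
    and sum: "(\<Sum>i\<in>UNIV. \<psi> \<omega> t z z' $ i) = 1"
    by (auto simp: mult_axis_nth simp del: atLeastAtMost_iff)
  let ?p = "\<psi> \<omega> t z z'"
  have A_nonneg: "A $ i $ j \<ge> 0" for i
    using stochastic by (simp add: column_stochastic_def)
  \<comment> \<open>A nonzero numerator over \<open>0\<close> would have quotient \<open>0\<close>,
    which is below \<open>\<gamma>\<close>; only the case \<open>0/0\<close> survives.\<close>
  have zero: "?p $ i = 0" if "A $ i $ j = 0" for i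
    using ratio[of i] that gamma by (auto simp: ratio_def split: if_splits)
  have lower: "\<gamma> * A $ i $ j \<le> ?p $ i" for i
  proof (cases "A $ i $ j = 0")
    case False
    then have "A $ i $ j > 0" using A_nonneg[of i] by simp
    then show ?thesis using ratio[of i] by (simp add: ratio_def field_simps)
  qed (simp add: zero)
  have "0 \<le> ?p $ i" for i
    using lower[of i] A_nonneg[of i] gamma by (meson mult_nonneg_nonneg less_imp_le order_trans)
  then have "?p \<in> balanced_law A \<gamma> j"
    using lower zero sum by (simp add: balanced_law_def prob_vec_def)
  then show ?thesis using eq by (rule that)
qed

section \<open>Martingale differences and the induced equivalence\<close>

lemma mart_diff_measurable [measurable]: "mart_diff A X t \<in> borel_measurable P"
proof -
  have "mart_diff A X t = (\<lambda>\<omega>. X (Suc t) \<omega> - (\<Sum>j\<in>UNIV. X t \<omega> $ j *\<^sub>R column j A))"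
    by (simp add: mart_diff_def fun_eq_iff matrix_mult_sum scalar_mult_eq_scaleR)
  then show ?thesis by simp
qed

lemma matrix_X_measurable [measurable]: "(\<lambda>\<omega>. A *v X t \<omega>) \<in> borel_measurable (filt P X t)"
  by (simp add: matrix_mult_sum scalar_mult_eq_scaleR)

lemma M_equivI:
  assumes "adapted P X Z" and "adapted P X Z'"
    and "\<And>t. AE \<omega> in P. (Z t \<omega> - Z' t \<omega>) \<bullet> mart_diff A X t \<omega> = 0"
  shows "M_equiv P A X Z Z'"
  unfolding M_equiv_def
proof
  fix t
  interpret S: finite_measure_subalgebra P "filt P X t"
    by (rule filt_subalgebra)
  have [measurable]: "Z t \<in> borel_measurable P" "Z' t \<in> borel_measurable P"
    using assms(1,2) by (auto simp: adapted_def intro: measurable_filt_P)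
  have "AE \<omega> in P. real_cond_exp P (filt P X t) (\<lambda>\<omega>. ((Z t \<omega> - Z' t \<omega>) \<bullet> mart_diff A X t \<omega>)\<^sup>2) \<omega>
          = real_cond_exp P (filt P X t) (\<lambda>\<omega>. 0) \<omega>"
  proof (rule S.real_cond_exp_cong)
    show "AE \<omega> in P. ((Z t \<omega> - Z' t \<omega>) \<bullet> mart_diff A X t \<omega>)\<^sup>2 = 0"
      using assms(3)[of t] by simp
  qed measurable
  moreover have "AE \<omega> in P. real_cond_exp P (filt P X t) (\<lambda>\<omega>. 0) \<omega> = 0"
    by (rule S.real_cond_exp_F_meas) auto
  ultimately show "AE \<omega> in P. M_seminorm P A X t (\<lambda>\<omega>. Z t \<omega> - Z' t \<omega>) \<omega> = 0"
    by eventually_elim (simp add: M_seminorm_def)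
qed

section \<open>Regularity of the driver at visited states\<close>

lemma column_prob_vec: "prob_vec (A *v e j)"
  by (rule column_stochastic_mult[OF stochastic prob_vec_axis])

text \<open>A Lipschitz estimate in the maximum norm: \<open>p\<close> and column \<open>j\<close>
  are both probability vectors, and each average contributes at most \<open>C\<close>.\<close>

lemma driver_bound:
  assumes "j \<in> W" and "\<And>i. \<bar>(z - z') $ i\<bar> \<le> C"
  shows "\<bar>f (e j) z - f (e j) z'\<bar> \<le> 2 * C"
proof -
  obtain p where "p \<in> balanced_law A \<gamma> j" and f: "f (e j) z - f (e j) z' = (z - z') \<bullet> (p - A *v e j)"
    using balanced_lawE[OF assms(1)] .
  then have "\<bar>(z - z') \<bullet> p\<bar> \<le> C"
    using prob_vec_bound[OF _ assms(2)] by (simp add: balanced_law_def)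
  moreover have "\<bar>(z - z') \<bullet> (A *v e j)\<bar> \<le> C"
    by (rule prob_vec_bound[OF column_prob_vec assms(2)])
  ultimately show ?thesis
    unfolding f inner_diff_right by linarith
qed

lemma driver_tendsto:
  assumes "j \<in> W" and "z \<longlonglongrightarrow> l"
  shows "(\<lambda>n. f (e j) (z n)) \<longlonglongrightarrow> f (e j) l"
proof -
  have "(\<lambda>n. 2 * norm (z n - l)) \<longlonglongrightarrow> 0"
    using assms(2) by (auto intro!: tendsto_eq_intros simp: LIM_zero_iff)
  then have "(\<lambda>n. f (e j) (z n) - f (e j) l) \<longlonglongrightarrow> 0"
    by (rule Lim_null_comparison[rotated])
      (simp add: driver_bound[OF assms(1) component_le_norm_cart])
  then show ?thesis by (simp add: LIM_zero_iff)
qed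

text \<open>A constant vector pairs to zero with the difference of two laws. This allows
  \<open>v\<alpha>\<close> to be normalized at \<open>x0\<close> inside the driver.\<close>

lemma driver_shift:
  assumes "j \<in> W" and "\<And>i. z $ i = z' $ i + c"
  shows "f (e j) z = f (e j) z'"
proof -
  have inner: "(z - z') \<bullet> p = c" if "prob_vec p" for p
    using that assms(2) by (simp add: inner_vec_sum prob_vec_def flip: sum_distrib_right)
  obtain p where "p \<in> balanced_law A \<gamma> j" and f: "f (e j) z - f (e j) z' = (z - z') \<bullet> (p - A *v e j)"
    using balanced_lawE[OF assms(1)] .
  then show ?thesis
    using inner[of p] inner[OF column_prob_vec, of j] by (simp add: balanced_law_def inner_diff_right)
qed

section \<open>The Poisson equation\<close>

text \<open>The function \<open>r\<close> is the constant \<open>lam\<close> in the ergodic case and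
  \<open>\<alpha> * v\<close> in the discounted case, so both equations share one treatment.\<close>

definition poisson :: "(real ^ 'n \<Rightarrow> real) \<Rightarrow> (real ^ 'n \<Rightarrow> real) \<Rightarrow> bool" where
  "poisson v r \<longleftrightarrow>
     (\<forall>j\<in>W. v (e j) + r (e j) = state_vec v \<bullet> (A *v e j) + f (e j) (state_vec v))"

text \<open>Since \<open>v(X\<^sub>t\<^sub>+\<^sub>1)\<close> depends on \<open>\<omega>\<close> only through the next state, averaging the equation over all
  possible next states determines its drift and, separately, its martingale part.\<close>

lemma markov_step:
  assumes Z: "Z \<in> borel_measurable (filt P X t)"
    and step: "AE \<omega> in P. v (X (Suc t) \<omega>)
      = v (X t \<omega>) - (f (X t \<omega>) (Z \<omega>) - r (X t \<omega>)) + Z \<omega> \<bullet> mart_diff A X t \<omega>"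
  shows "AE \<omega> in P. (state_vec v - Z \<omega>) \<bullet> mart_diff A X t \<omega> = 0 \<and>
    v (X t \<omega>) + r (X t \<omega>) = state_vec v \<bullet> (A *v X t \<omega>) + f (X t \<omega>) (state_vec v)"
proof -
  \<comment> \<open>The one-step equation with \<open>e i\<close> in place of the next state; all
    its other terms are known at time \<open>t\<close>, as \<open>next_state_AE\<close>
    requires.\<close>
  define Q where "Q i \<omega> \<longleftrightarrow>
    v (e i) = v (X t \<omega>) - (f (X t \<omega>) (Z \<omega>) - r (X t \<omega>)) + Z \<omega> \<bullet> (e i - A *v X t \<omega>)" for i \<omega>
  have Q: "AE \<omega> in P. \<forall>i. X (Suc t) \<omega> = e i \<longrightarrow> Q i \<omega>"
    using step by eventually_elim (auto simp: Q_def mart_diff_def)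
  have "AE \<omega> in P. \<forall>i. (A *v X t \<omega>) $ i > 0 \<longrightarrow> Q i \<omega>"
  proof (rule next_state_AE[OF _ Q])
    fix i
    have [measurable]: "Z \<in> borel_measurable (filt P X t)" by (rule Z)
    have "{\<omega> \<in> space (filt P X t). Q i \<omega>} \<in> sets (filt P X t)"
      unfolding Q_def by measurable
    then show "{\<omega> \<in> space P. Q i \<omega>} \<in> sets (filt P X t)" by simp
  qed
  then show ?thesis
    using Q AE_X_visited
  proof eventually_elim
    case (elim \<omega>)
    obtain j where j: "j \<in> W" and X: "X t \<omega> = e j"
      using elim(3) by blast
    obtain k where k: "X (Suc t) \<omega> = e k"
      using elim(3) by blast
    define a where "a = A *v e j"
    define K where "K = v (e j) - (f (e j) (Z \<omega>) - r (e j))"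
    have a: "prob_vec a"
      unfolding a_def by (rule column_prob_vec)
    have Qi: "v (e i) = K + Z \<omega> \<bullet> (e i - a)" if "Q i \<omega>" for i
      using that by (simp add: Q_def X K_def a_def)
    have pos: "Q i \<omega>" if "a $ i \<noteq> 0" for i
      using elim(1) that a X by (metis a_def prob_vec_def order_le_less)
    have diff: "state_vec v \<bullet> (e i - a) + state_vec v \<bullet> a = K + Z \<omega> \<bullet> (e i - a)" if "Q i \<omega>" for i
      using Qi[OF that] by (simp add: inner_diff_right state_vec_inner)
    \<comment> \<open>The increments \<open>Z \<omega> \<bullet> (e i - a)\<close> average to zero
      under \<open>a\<close>, which isolates the drift \<open>K\<close>.\<close>
    have K: "state_vec v \<bullet> a = K"
    proof -
      have "state_vec v \<bullet> a = (\<Sum>i\<in>UNIV. a $ i * v (e i))"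
        by (simp add: inner_vec_sum state_vec_def)
      also have "\<dots> = (\<Sum>i\<in>UNIV. a $ i * K + a $ i * (Z \<omega> \<bullet> (e i - a)))"
        using Qi[OF pos] by (intro sum.cong) (auto simp flip: distrib_left)
      also have "\<dots> = K + Z \<omega> \<bullet> (a - a)"
        unfolding inner_prob_vec_diff[OF a]
        using a by (simp add: sum.distrib prob_vec_def flip: sum_distrib_right)
      finally show ?thesis by simp
    qed
    obtain p where p: "p \<in> balanced_law A \<gamma> j"
      and f: "f (e j) (state_vec v) - f (e j) (Z \<omega>) = (state_vec v - Z \<omega>) \<bullet> (p - a)"
      unfolding a_def using balanced_lawE[OF j] .
    \<comment> \<open>Off the support of \<open>a\<close> the law \<open>p\<close> vanishes; on it
      \<open>state_vec v\<close> and \<open>Z \<omega>\<close> have equal increments. Hence the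
      driver takes the same value at both vectors.\<close>
    have zero: "p $ i * ((state_vec v - Z \<omega>) \<bullet> (e i - a)) = 0" for i
    proof (cases "a $ i = 0")
      case True
      then show ?thesis using p by (simp add: balanced_law_def a_def mult_axis_nth)
    next
      case False
      then show ?thesis using diff[OF pos[OF False]] K by (simp add: inner_diff_left)
    qed
    have "prob_vec p"
      using p by (simp add: balanced_law_def)
    then have "f (e j) (state_vec v) = f (e j) (Z \<omega>)"
      using f by (simp only: inner_prob_vec_diff zero sum.neutral_const right_minus_eq)
    moreover have "(state_vec v - Z \<omega>) \<bullet> (e k - a) = 0"
      using diff[of k] elim(2) k K by (simp add: inner_diff_left)
    ultimately show ?case
      using K by (simp add: X k mart_diff_def a_def K_def)
  qed
qed

lemma poissonI:
  assumes "\<And>t. AE \<omega> in P.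
    v (X t \<omega>) + r (X t \<omega>) = state_vec v \<bullet> (A *v X t \<omega>) + f (X t \<omega>) (state_vec v)"
  shows "poisson v r"
  unfolding poisson_def
proof
  fix j assume "j \<in> W"
  then have "visited P X (e j)" by (simp add: W_def)
  from visited_AE_witness[OF this, of "\<lambda>t \<omega>.
    v (X t \<omega>) + r (X t \<omega>) = state_vec v \<bullet> (A *v X t \<omega>) + f (X t \<omega>) (state_vec v)"] assms
  show "v (e j) + r (e j) = state_vec v \<bullet> (A *v e j) + f (e j) (state_vec v)"
    by auto
qed

section \<open>From solutions to the Poisson equation and back\<close>

lemma markovian_ergodic_solution:
  assumes sol: "ergodic_solution P X A f Y Z lam" and Y: "represents P X v Y"
  shows "poisson v (\<lambda>x. lam)" and "AE \<omega> in P. (state_vec v - Z t \<omega>) \<bullet> mart_diff A X t \<omega> = 0"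
proof -
  have "AE \<omega> in P. (state_vec v - Z t \<omega>) \<bullet> mart_diff A X t \<omega> = 0 \<and>
    v (X t \<omega>) + lam = state_vec v \<bullet> (A *v X t \<omega>) + f (X t \<omega>) (state_vec v)" for t
  proof (rule markov_step)
    show "Z t \<in> borel_measurable (filt P X t)"
      using sol by (simp add: ergodic_solution_def adapted_def)
    have "AE \<omega> in P. Y (Suc t) \<omega> = Y t \<omega> - (\<Sum>u\<in>{t..<Suc t}. f (X u \<omega>) (Z u \<omega>) - lam)
        + (\<Sum>u\<in>{t..<Suc t}. Z u \<omega> \<bullet> mart_diff A X u \<omega>)"
      using sol unfolding ergodic_solution_def by blast
    then show "AE \<omega> in P. v (X (Suc t) \<omega>)
        = v (X t \<omega>) - (f (X t \<omega>) (Z t \<omega>) - lam) + Z t \<omega> \<bullet> mart_diff A X t \<omega>"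
      using Y unfolding represents_def by eventually_elim simp
  qed
  then show "poisson v (\<lambda>x. lam)" and "AE \<omega> in P. (state_vec v - Z t \<omega>) \<bullet> mart_diff A X t \<omega> = 0"
    by (auto intro!: poissonI)
qed

lemma discounted_value_poisson:
  assumes "discounted_value P X A f \<alpha> v"
  shows "poisson v (\<lambda>x. \<alpha> * v x)"
proof -
  obtain Y Z where sol: "discounted_solution P X A f \<alpha> Y Z" and Y: "represents P X v Y"
    using assms by (auto simp: discounted_value_def)
  have "AE \<omega> in P. (state_vec v - Z t \<omega>) \<bullet> mart_diff A X t \<omega> = 0 \<and>
    v (X t \<omega>) + \<alpha> * v (X t \<omega>) = state_vec v \<bullet> (A *v X t \<omega>) + f (X t \<omega>) (state_vec v)" for t
  proof (rule markov_step)
    show "Z t \<in> borel_measurable (filt P X t)"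
      using sol by (simp add: discounted_solution_def adapted_def)
    have "AE \<omega> in P. Y (Suc t) \<omega> = Y t \<omega> - (\<Sum>u\<in>{t..<Suc t}. f (X u \<omega>) (Z u \<omega>) - \<alpha> * Y u \<omega>)
        + (\<Sum>u\<in>{t..<Suc t}. Z u \<omega> \<bullet> mart_diff A X u \<omega>)"
      using sol unfolding discounted_solution_def by blast
    then show "AE \<omega> in P. v (X (Suc t) \<omega>)
        = v (X t \<omega>) - (f (X t \<omega>) (Z t \<omega>) - \<alpha> * v (X t \<omega>)) + Z t \<omega> \<bullet> mart_diff A X t \<omega>"
      using Y unfolding represents_def by eventually_elim simp
  qed
  then show ?thesis
    by (auto intro!: poissonI)
qed

text \<open>At visited states the Poisson equation is the one-step equation, and the increments of
  \<open>v (X u \<omega>)\<close> telescope.\<close>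

lemma poisson_ergodic_solution:
  assumes "poisson v (\<lambda>x. lam)"
  shows "ergodic_solution P X A f (\<lambda>t \<omega>. v (X t \<omega>)) (\<lambda>t \<omega>. state_vec v) lam"
  unfolding ergodic_solution_def
proof (intro conjI allI impI)
  fix t T :: nat assume "t < T"
  show "AE \<omega> in P. v (X T \<omega>) = v (X t \<omega>) - (\<Sum>u\<in>{t..<T}. f (X u \<omega>) (state_vec v) - lam)
      + (\<Sum>u\<in>{t..<T}. state_vec v \<bullet> mart_diff A X u \<omega>)"
    using AE_X_visited
  proof eventually_elim
    case (elim \<omega>)
    have "v (X (Suc u) \<omega>) - v (X u \<omega>)
        = state_vec v \<bullet> mart_diff A X u \<omega> - (f (X u \<omega>) (state_vec v) - lam)" for u
    proof -
      obtain j where "j \<in> W" and j: "X u \<omega> = e j" using elim by blast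
      then have "v (e j) + lam = state_vec v \<bullet> (A *v e j) + f (e j) (state_vec v)"
        using assms by (simp add: poisson_def)
      moreover obtain i where "X (Suc u) \<omega> = e i" using elim by blast
      ultimately show ?thesis
        by (simp add: j mart_diff_def inner_diff_right state_vec_inner)
    qed
    then have "(\<Sum>u\<in>{t..<T}. state_vec v \<bullet> mart_diff A X u \<omega> - (f (X u \<omega>) (state_vec v) - lam))
        = v (X T \<omega>) - v (X t \<omega>)"
      using sum_Suc_diff'[of t T "\<lambda>u. v (X u \<omega>)"] \<open>t < T\<close> by simp
    then show ?case
      by (simp only: sum_subtractf)
  qed
qed (auto simp: adapted_def)

section \<open>Comparison of two bounded solutions, and uniqueness for the Poisson equation\<close>

lemma ergodic_constant_le:
  assumes sol: "ergodic_solution P X A f Y Z lam" "ergodic_solution P X A f Y' Z' lam'"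
    and bdd: "uniformly_bounded P Y" "uniformly_bounded P Y'"
  shows "lam' \<le> lam"
proof (rule ccontr)
  define d where "d = lam' - lam"
  define D where "D t \<omega> = Y' t \<omega> - Y t \<omega>" for t \<omega>
  assume "\<not> lam' \<le> lam"
  then have d: "d > 0" by (simp add: d_def)
  have meas: "Y t \<in> borel_measurable (filt P X t)" "Z t \<in> borel_measurable (filt P X t)"
    "Y' t \<in> borel_measurable (filt P X t)" "Z' t \<in> borel_measurable (filt P X t)" for t
    using sol by (simp_all add: ergodic_solution_def adapted_def)
  obtain C1 C2 where C: "AE \<omega> in P. \<forall>t. \<bar>Y t \<omega>\<bar> \<le> C1" "AE \<omega> in P. \<forall>t. \<bar>Y' t \<omega>\<bar> \<le> C2"
    using bdd by (auto simp: uniformly_bounded_def)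
  define C where "C = C1 + C2"
  have bound: "AE \<omega> in P. \<bar>D t \<omega>\<bar> \<le> C" for t
    using C
  proof eventually_elim
    case (elim \<omega>)
    then show ?case
      using elim(1)[rule_format, of t] elim(2)[rule_format, of t] unfolding D_def C_def by linarith
  qed
  \<comment> \<open>Going back one time step lowers an almost sure upper bound on the difference by
    \<open>d\<close>.\<close>
  have step: "AE \<omega> in P. D t \<omega> \<le> c - d" if D: "AE \<omega> in P. D (Suc t) \<omega> \<le> c" for t c
  proof -
    define F where "F \<omega> = f (X t \<omega>) (Z' t \<omega>) - f (X t \<omega>) (Z t \<omega>)" for \<omega>
    define Q where "Q i \<omega> \<longleftrightarrow>
      D t \<omega> - F \<omega> + d + (Z' t \<omega> - Z t \<omega>) \<bullet> (e i - A *v X t \<omega>) \<le> c" for i \<omega>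
    have "AE \<omega> in P. Y (Suc t) \<omega> = Y t \<omega> - (\<Sum>u\<in>{t..<Suc t}. f (X u \<omega>) (Z u \<omega>) - lam)
        + (\<Sum>u\<in>{t..<Suc t}. Z u \<omega> \<bullet> mart_diff A X u \<omega>)"
      using sol(1) unfolding ergodic_solution_def by blast
    moreover have "AE \<omega> in P. Y' (Suc t) \<omega> = Y' t \<omega> - (\<Sum>u\<in>{t..<Suc t}. f (X u \<omega>) (Z' u \<omega>) - lam')
        + (\<Sum>u\<in>{t..<Suc t}. Z' u \<omega> \<bullet> mart_diff A X u \<omega>)"
      using sol(2) unfolding ergodic_solution_def by blast
    ultimately have "AE \<omega> in P. \<forall>i. X (Suc t) \<omega> = e i \<longrightarrow> Q i \<omega>"
      using D
      by eventually_elim (auto simp: Q_def D_def F_def d_def mart_diff_def inner_diff_left)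
    moreover have "{\<omega> \<in> space P. Q i \<omega>} \<in> sets (filt P X t)" for i
    proof -
      note meas [measurable]
      have "{\<omega> \<in> space (filt P X t). Q i \<omega>} \<in> sets (filt P X t)"
        unfolding Q_def D_def F_def by measurable
      then show ?thesis by simp
    qed
    ultimately have "AE \<omega> in P. \<forall>i. (A *v X t \<omega>) $ i > 0 \<longrightarrow> Q i \<omega>"
      by (intro next_state_AE)
    then show ?thesis
      using AE_X_visited
    proof eventually_elim
      case (elim \<omega>)
      obtain j where j: "j \<in> W" and X: "X t \<omega> = e j"
        using elim(2) by blast
      define w where "w = Z' t \<omega> - Z t \<omega>"
      obtain p where p: "p \<in> balanced_law A \<gamma> j" and "F \<omega> = w \<bullet> (p - A *v e j)"
        unfolding F_def w_def X using balanced_lawE[OF j] .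
      then have "F \<omega> = (\<Sum>i\<in>UNIV. p $ i * (w \<bullet> (e i - A *v e j)))"
        using inner_prob_vec_diff[of p] by (simp add: balanced_law_def)
      \<comment> \<open>\<open>Q i \<omega>\<close> bounds each increment that \<open>p\<close>
        charges. As \<open>p\<close> has mass one, \<open>F \<omega>\<close> then stands on both
        sides and cancels.\<close>
      also have "\<dots> \<le> (\<Sum>i\<in>UNIV. p $ i * (c - D t \<omega> + F \<omega> - d))"
      proof (rule sum_mono)
        fix i
        show "p $ i * (w \<bullet> (e i - A *v e j)) \<le> p $ i * (c - D t \<omega> + F \<omega> - d)"
        proof (cases "A $ i $ j = 0")
          case True
          then show ?thesis using p by (simp add: balanced_law_def)
        next
          case False
          then have "Q i \<omega>"
            using elim(1) stochastic by (metis X column_stochastic_def mult_axis_nth order_le_less)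
          then show ?thesis
            using p by (intro mult_left_mono) (auto simp: Q_def X w_def balanced_law_def prob_vec_def)
        qed
      qed
      also have "\<dots> = c - D t \<omega> + F \<omega> - d"
        using p by (simp add: balanced_law_def prob_vec_def flip: sum_distrib_right)
      finally show ?case by simp
    qed
  qed
  \<comment> \<open>The initial bound \<open>C\<close> holds at all times, so time \<open>t\<close>
    is reached from time \<open>t + n\<close> by \<open>n\<close> backward steps, each gaining
    \<open>d\<close>.\<close>
  have iter: "AE \<omega> in P. D t \<omega> \<le> C - real n * d" for n t
  proof (induction n arbitrary: t)
    case 0
    show ?case using bound[of t] by eventually_elim simp
  next
    case (Suc n)
    have "C - real n * d - d = C - real (Suc n) * d" by (simp add: algebra_simps)
    with step[OF Suc, of t] show ?case by simp
  qed
  \<comment> \<open>This pushes \<open>C - real n * d\<close> below \<open>- C\<close>, against the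
    lower bound on \<open>D 0\<close>.\<close>
  obtain n where n: "2 * C < real n * d"
    using reals_Archimedean3[OF d] by blast
  have "AE \<omega> in P. False"
    using iter[of 0 n] bound[of 0] by eventually_elim (use n in auto)
  then show False by simp
qed

text \<open>Linearizing the driver cancels the column terms and leaves a difference that is harmonic
  for balanced laws; the oscillation bound with defect \<open>0\<close> makes it constant on
  \<open>W\<close>.\<close>

lemma poisson_unique:
  assumes "poisson v (\<lambda>x. lam)" and "poisson v' (\<lambda>x. lam)"
  obtains c where "\<And>j. j \<in> W \<Longrightarrow> v (e j) = v' (e j) + c"
proof -
  define w where "w = state_vec v - state_vec v'"
  obtain K where K: "\<And>w c i j. \<lbrakk>\<And>j. j \<in> W \<Longrightarrow> \<exists>p\<in>balanced_law A \<gamma> j. \<bar>w $ j - w \<bullet> p\<bar> \<le> c;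
    c \<ge> 0; i \<in> W; j \<in> W\<rbrakk> \<Longrightarrow> \<bar>w $ i - w $ j\<bar> \<le> K * c"
    using oscillation_bound[OF stochastic ergodic W_closed gamma(1) less_imp_le[OF gamma(2)]] by metis
  have harmonic: "\<exists>p\<in>balanced_law A \<gamma> j. \<bar>w $ j - w \<bullet> p\<bar> \<le> 0" if j: "j \<in> W" for j
  proof -
    obtain p where p: "p \<in> balanced_law A \<gamma> j"
      and "f (e j) (state_vec v) - f (e j) (state_vec v') = w \<bullet> (p - A *v e j)"
      unfolding w_def using balanced_lawE[OF j] .
    moreover have "w $ j = w \<bullet> (A *v e j) + f (e j) (state_vec v) - f (e j) (state_vec v')"
      using assms j by (fastforce simp: poisson_def w_def state_vec_nth inner_diff_left)
    ultimately have "w $ j = w \<bullet> p"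
      by (simp add: inner_diff_right)
    with p show ?thesis by force
  qed
  obtain k where k: "k \<in> W" using W_nonempty by blast
  have "v (e j) = v' (e j) + w $ k" if "j \<in> W" for j
    using K[OF harmonic _ that k] by (simp add: w_def state_vec_def)
  then show ?thesis by (rule that)
qed

section \<open>The vanishing discount limit\<close>

text \<open>The discounted equation is rewritten for the normalized values \<open>h n\<close>, which
  converge although the values of \<open>v\<alpha>\<close> may not. The discount term tends to
  \<open>lam\<close>, and the driver is continuous.\<close>

lemma vanishing_discount_poisson:
  assumes disc: "\<And>\<alpha>. \<alpha> > 0 \<Longrightarrow> discounted_value P X A f \<alpha> (v\<alpha> \<alpha>)"
    and lim: "vanishing_discount_limit v\<alpha> x0 \<alpha> lam v"
  shows "poisson v (\<lambda>x. lam)"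
  unfolding poisson_def
proof
  fix j assume j: "j \<in> W"
  define V where "V n = state_vec (v\<alpha> (\<alpha> n))" for n
  define h where "h n = (\<chi> i. v\<alpha> (\<alpha> n) (e i) - v\<alpha> (\<alpha> n) x0)" for n
  have h: "h \<longlonglongrightarrow> state_vec v"
    unfolding h_def state_vec_def
    by (rule tendsto_vec_lambda) (use lim in \<open>auto simp: vanishing_discount_limit_def states_def\<close>)
  have "h n $ j + \<alpha> n * v\<alpha> (\<alpha> n) (e j) = h n \<bullet> (A *v e j) + f (e j) (h n)" for n
  proof -
    have "poisson (v\<alpha> (\<alpha> n)) (\<lambda>x. \<alpha> n * v\<alpha> (\<alpha> n) x)"
      by (rule discounted_value_poisson[OF disc]) (use lim in \<open>simp add: vanishing_discount_limit_def\<close>)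
    then have eq: "v\<alpha> (\<alpha> n) (e j) + \<alpha> n * v\<alpha> (\<alpha> n) (e j) = V n \<bullet> (A *v e j) + f (e j) (V n)"
      using j by (simp add: poisson_def V_def)
    have "h n \<bullet> (A *v e j) = V n \<bullet> (A *v e j) - v\<alpha> (\<alpha> n) x0"
      using column_prob_vec[of j]
      by (simp add: inner_vec_sum h_def V_def state_vec_nth right_diff_distrib sum_subtractf prob_vec_def
          flip: sum_distrib_right)
    moreover have "f (e j) (V n) = f (e j) (h n)"
      by (rule driver_shift[OF j, of _ _ "v\<alpha> (\<alpha> n) x0"]) (simp add: V_def h_def state_vec_nth)
    ultimately show ?thesis
      using eq by (simp add: h_def)
  qed
  moreover have "(\<lambda>n. h n $ j + \<alpha> n * v\<alpha> (\<alpha> n) (e j)) \<longlonglongrightarrow> state_vec v $ j + lam"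
    using lim by (intro tendsto_intros h) (auto simp: vanishing_discount_limit_def states_def)
  moreover have "(\<lambda>n. h n \<bullet> (A *v e j) + f (e j) (h n))
      \<longlonglongrightarrow> state_vec v \<bullet> (A *v e j) + f (e j) (state_vec v)"
    by (intro tendsto_intros driver_tendsto j h)
  ultimately show "v (e j) + lam = state_vec v \<bullet> (A *v e j) + f (e j) (state_vec v)"
    using LIMSEQ_unique by (simp add: state_vec_nth)
qed

text \<open>The maximum principle bounds \<open>\<alpha> v\<^sup>\<alpha>\<close>; then \<open>v\<^sup>\<alpha>\<close> is harmonic for a balanced kernel up to a
  bounded defect, whence the oscillation bound.\<close>

lemma discounted_bounds:
  assumes all: "W = UNIV"
  obtains C D where "\<And>\<alpha> v i. \<lbrakk>\<alpha> > 0; poisson v (\<lambda>x. \<alpha> * v x)\<rbrakk> \<Longrightarrow> \<bar>\<alpha> * v (e i)\<bar> \<le> C"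
    and "\<And>\<alpha> v i j. \<lbrakk>\<alpha> > 0; poisson v (\<lambda>x. \<alpha> * v x)\<rbrakk> \<Longrightarrow> \<bar>v (e i) - v (e j)\<bar> \<le> D"
proof -
  obtain K where K: "\<And>w c i j. \<lbrakk>\<And>j. j \<in> W \<Longrightarrow> \<exists>p\<in>balanced_law A \<gamma> j. \<bar>w $ j - w \<bullet> p\<bar> \<le> c;
    c \<ge> 0; i \<in> W; j \<in> W\<rbrakk> \<Longrightarrow> \<bar>w $ i - w $ j\<bar> \<le> K * c"
    using oscillation_bound[OF stochastic ergodic W_closed gamma(1) less_imp_le[OF gamma(2)]] by metis
  \<comment> \<open>Comparing the driver at \<open>state_vec v\<close> with its value at
    \<open>0\<close> absorbs the nonlinearity into a law \<open>p\<close>, so only the values at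
    \<open>0\<close> enter the bounds.\<close>
  define C where "C = Max (range (\<lambda>j. \<bar>f (e j) 0\<bar>))"
  have C: "\<bar>f (e j) 0\<bar> \<le> C" for j
    unfolding C_def by (intro Max_ge) auto
  then have C_nonneg: "C \<ge> 0"
    using abs_ge_zero order_trans by blast
  have law: "\<exists>p\<in>balanced_law A \<gamma> j. v (e j) + \<alpha> * v (e j) = state_vec v \<bullet> p + f (e j) 0"
    if "poisson v (\<lambda>x. \<alpha> * v x)" for v \<alpha> j
  proof -
    have j: "j \<in> W" by (simp add: all)
    obtain p where p: "p \<in> balanced_law A \<gamma> j"
      and "f (e j) (state_vec v) - f (e j) 0 = (state_vec v - 0) \<bullet> (p - A *v e j)"
      using balanced_lawE[OF j] .
    moreover have "v (e j) + \<alpha> * v (e j) = state_vec v \<bullet> (A *v e j) + f (e j) (state_vec v)"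
      using that j by (simp add: poisson_def)
    ultimately have "v (e j) + \<alpha> * v (e j) = state_vec v \<bullet> p + f (e j) 0"
      by (simp add: inner_diff_right)
    with p show ?thesis ..
  qed
  have 1: "\<bar>\<alpha> * v (e i)\<bar> \<le> C" if pos: "\<alpha> > 0" and pv: "poisson v (\<lambda>x. \<alpha> * v x)" for \<alpha> v i
  proof -
    define M where "M = Max (range (\<lambda>i. \<bar>v (e i)\<bar>))"
    have M: "\<bar>v (e i)\<bar> \<le> M" for i
      unfolding M_def by (intro Max_ge) auto
    have "M \<in> range (\<lambda>i. \<bar>v (e i)\<bar>)"
      unfolding M_def by (intro Max_in) auto
    \<comment> \<open>Where the absolute value of \<open>v\<close> is maximal, the average under
      \<open>p\<close> is at most \<open>M\<close>, so
      \<open>M + \<alpha> * M \<le> M + C\<close>.\<close>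
    then obtain j where j: "\<bar>v (e j)\<bar> = M" by auto
    obtain p where "p \<in> balanced_law A \<gamma> j" and eq: "v (e j) + \<alpha> * v (e j) = state_vec v \<bullet> p + f (e j) 0"
      using law[OF pv] by blast
    then have "\<bar>state_vec v \<bullet> p\<bar> \<le> M"
      using M by (intro prob_vec_bound) (auto simp: balanced_law_def state_vec_nth)
    moreover have "\<bar>v (e j) + \<alpha> * v (e j)\<bar> = M + \<alpha> * M"
    proof -
      have "\<bar>v (e j) + \<alpha> * v (e j)\<bar> = \<bar>(1 + \<alpha>) * v (e j)\<bar>"
        by (simp add: distrib_right)
      also have "\<dots> = (1 + \<alpha>) * M"
        using pos j by (simp add: abs_mult)
      finally show ?thesis
        by (simp add: distrib_right)
    qed
    ultimately have "\<alpha> * M \<le> C"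
      using eq C[of j] by linarith
    moreover have "\<bar>\<alpha> * v (e i)\<bar> \<le> \<alpha> * M"
      using pos M[of i] by (simp add: abs_mult)
    ultimately show ?thesis by linarith
  qed
  have 2: "\<bar>v (e i) - v (e j)\<bar> \<le> K * (2 * C)" if pos: "\<alpha> > 0" and pv: "poisson v (\<lambda>x. \<alpha> * v x)" for \<alpha> v i j
  proof -
    \<comment> \<open>The terms \<open>\<alpha> * v (e j)\<close> and \<open>f (e j) 0\<close> are
      each at most \<open>C\<close> in absolute value, so the defect \<open>2 * C\<close> is
      independent of \<open>\<alpha>\<close>.\<close>
    have "\<exists>p\<in>balanced_law A \<gamma> j. \<bar>state_vec v $ j - state_vec v \<bullet> p\<bar> \<le> 2 * C" for j
    proof -
      obtain p where p: "p \<in> balanced_law A \<gamma> j" and "v (e j) + \<alpha> * v (e j) = state_vec v \<bullet> p + f (e j) 0"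
        using law[OF pv] by blast
      then have "\<bar>state_vec v $ j - state_vec v \<bullet> p\<bar> \<le> 2 * C"
        using C[of j] 1[OF pos pv, of j] unfolding state_vec_nth by linarith
      with p show ?thesis by blast
    qed
    then have "\<bar>state_vec v $ i - state_vec v $ j\<bar> \<le> K * (2 * C)"
      by (intro K) (use C_nonneg all in auto)
    then show ?thesis by (simp add: state_vec_nth)
  qed
  show ?thesis
    by (rule that[of C "K * (2 * C)"]) (use 1 2 in blast)+
qed

text \<open>The bounds uniform in the discount confine the normalized values \<open>h\<close> and
  the scaled values \<open>g\<close> to bounded sets in finite dimension, so one subsequence makes
  both converge.\<close>

lemma vanishing_discount_limit_exists:
  assumes all: "W = UNIV" and x0: "x0 = e k0"
    and disc: "\<And>\<alpha>. \<alpha> > 0 \<Longrightarrow> discounted_value P X A f \<alpha> (v\<alpha> \<alpha>)"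
  shows "\<exists>\<alpha> lam v. vanishing_discount_limit v\<alpha> x0 \<alpha> lam v"
proof -
  define \<beta> :: "nat \<Rightarrow> real" where "\<beta> n = inverse (real (Suc n))" for n
  have \<beta>_pos: "\<beta> n > 0" for n by (simp add: \<beta>_def)
  have poisson_\<beta>: "poisson (v\<alpha> (\<beta> n)) (\<lambda>x. \<beta> n * v\<alpha> (\<beta> n) x)" for n
    by (rule discounted_value_poisson[OF disc[OF \<beta>_pos]])
  obtain C D where C: "\<And>\<alpha> v i. \<lbrakk>\<alpha> > 0; poisson v (\<lambda>x. \<alpha> * v x)\<rbrakk> \<Longrightarrow> \<bar>\<alpha> * v (e i)\<bar> \<le> C"
    and D: "\<And>\<alpha> v i j. \<lbrakk>\<alpha> > 0; poisson v (\<lambda>x. \<alpha> * v x)\<rbrakk> \<Longrightarrow> \<bar>v (e i) - v (e j)\<bar> \<le> D"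
    using discounted_bounds[OF all] by metis
  define h :: "nat \<Rightarrow> real ^ 'n" where "h n = (\<chi> i. v\<alpha> (\<beta> n) (e i) - v\<alpha> (\<beta> n) x0)" for n
  define g :: "nat \<Rightarrow> real ^ 'n" where "g n = (\<chi> i. \<beta> n * v\<alpha> (\<beta> n) (e i))" for n
  have "bounded (range h)"
    by (rule bounded_range_vec[of _ D]) (simp add: h_def x0 D[OF \<beta>_pos poisson_\<beta>])
  moreover have "bounded (range g)"
    by (rule bounded_range_vec[of _ C]) (simp add: g_def C[OF \<beta>_pos poisson_\<beta>])
  ultimately have "bounded (range (\<lambda>n. (h n, g n)))"
    by (rule bounded_subset[OF bounded_Times]) auto
  from bounded_imp_convergent_subsequence[OF this]
  obtain l r where r: "strict_mono r" and l: "((\<lambda>n. (h n, g n)) \<circ> r) \<longlonglongrightarrow> l"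
    by blast
  have h_lim: "(\<lambda>n. h (r n) $ i) \<longlonglongrightarrow> fst l $ i" for i
    using tendsto_vec_nth[OF tendsto_fst[OF l]] by (simp add: o_def)
  have g_lim: "(\<lambda>n. g (r n) $ i) \<longlonglongrightarrow> snd l $ i" for i
    using tendsto_vec_nth[OF tendsto_snd[OF l]] by (simp add: o_def)
  have \<beta>_lim: "(\<lambda>n. \<beta> (r n)) \<longlonglongrightarrow> 0"
    using LIMSEQ_subseq_LIMSEQ[OF LIMSEQ_inverse_real_of_nat r] by (simp add: \<beta>_def o_def)
  have "decseq \<beta>"
    by (auto simp: \<beta>_def decseq_def field_simps)
  then have "decseq (\<lambda>n. \<beta> (r n))"
    using strict_mono_mono[OF r] by (auto simp: decseq_def mono_def)
  \<comment> \<open>A linear function can serve as the limit: on basis vectors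
    \<open>fst l \<bullet> x\<close> reads off the entries of the limit of \<open>h\<close>.\<close>
  moreover have "(\<lambda>n. v\<alpha> (\<beta> (r n)) x - v\<alpha> (\<beta> (r n)) x0) \<longlonglongrightarrow> fst l \<bullet> x"
    and "(\<lambda>n. \<beta> (r n) * v\<alpha> (\<beta> (r n)) x) \<longlonglongrightarrow> snd l $ k0" if x_state: "x \<in> states" for x
  proof -
    obtain i where x: "x = e i" using x_state by (auto simp: states_def)
    show "(\<lambda>n. v\<alpha> (\<beta> (r n)) x - v\<alpha> (\<beta> (r n)) x0) \<longlonglongrightarrow> fst l \<bullet> x"
      using h_lim[of i] by (simp add: h_def x inner_axis)
    \<comment> \<open>Since \<open>h\<close> converges along the subsequence and
      \<open>\<beta>\<close> tends to \<open>0\<close>, the scaled values at every state share the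
      limit found at \<open>x0\<close>.\<close>
    have "(\<lambda>n. \<beta> (r n) * h (r n) $ i + g (r n) $ k0) \<longlonglongrightarrow> 0 * fst l $ i + snd l $ k0"
      by (intro tendsto_intros h_lim g_lim \<beta>_lim)
    moreover have "\<beta> (r n) * h (r n) $ i + g (r n) $ k0 = \<beta> (r n) * v\<alpha> (\<beta> (r n)) x" for n
      by (simp add: h_def g_def x x0 right_diff_distrib)
    ultimately show "(\<lambda>n. \<beta> (r n) * v\<alpha> (\<beta> (r n)) x) \<longlonglongrightarrow> snd l $ k0" by simp
  qed
  ultimately have "vanishing_discount_limit v\<alpha> x0 (\<lambda>n. \<beta> (r n)) (snd l $ k0) (\<lambda>x. fst l \<bullet> x)"
    using \<beta>_pos \<beta>_lim by (simp add: vanishing_discount_limit_def)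
  then show ?thesis by blast
qed

section \<open>Boundedness and uniqueness of Markovian solutions\<close>

lemma state_function_bounded: "uniformly_bounded P (\<lambda>t \<omega>. v (X t \<omega>))"
proof -
  have bound: "\<bar>v (e j)\<bar> \<le> (\<Sum>i\<in>UNIV. \<bar>v (e i)\<bar>)" for j :: 'n
    by (rule member_le_sum) auto
  have "AE \<omega> in P. \<forall>t. \<bar>v (X t \<omega>)\<bar> \<le> (\<Sum>i\<in>UNIV. \<bar>v (e i)\<bar>)"
    using AE_X_visited by eventually_elim (metis bound)
  then show ?thesis
    by (auto simp: uniformly_bounded_def)
qed

text \<open>The functions \<open>v\<close> and \<open>v'\<close> differ by a constant on
  \<open>W\<close>. Both terms of \<open>mart_diff\<close> have mass one on \<open>W\<close>, so
  this constant is invisible there, and \<open>state_vec v\<close> can replace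
  \<open>state_vec v'\<close> in the comparison with \<open>Z'\<close>.\<close>

lemma markovian_solution_unique:
  assumes v: "poisson v (\<lambda>x. lam)" and sol: "ergodic_solution P X A f Y' Z' lam"
    and Y': "represents P X v' Y'"
  obtains c where "indistinguishable P (\<lambda>t \<omega>. v (X t \<omega>)) (\<lambda>t \<omega>. Y' t \<omega> + c)"
    and "M_equiv P A X (\<lambda>t \<omega>. state_vec v) Z'"
    and "\<And>j. j \<in> W \<Longrightarrow> v (e j) = v' (e j) + c"
proof -
  obtain c where c: "\<And>j. j \<in> W \<Longrightarrow> v (e j) = v' (e j) + c"
    using poisson_unique[OF v markovian_ergodic_solution(1)[OF sol Y']] by metis
  have "AE \<omega> in P. \<forall>t. v (X t \<omega>) = Y' t \<omega> + c"
    using AE_X_visited Y' unfolding represents_def by eventually_elim (metis c)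
  then have indist: "indistinguishable P (\<lambda>t \<omega>. v (X t \<omega>)) (\<lambda>t \<omega>. Y' t \<omega> + c)"
    by (simp add: indistinguishable_def)
  define w where "w = state_vec v - state_vec v'"
  have w: "w $ i = c" if "i \<in> W" for i
    using c[OF that] by (simp add: w_def state_vec_nth)
  \<comment> \<open>Nothing is known about \<open>w\<close> outside \<open>W\<close>, but the column
    of a visited state carries no mass there.\<close>
  have w_column: "w \<bullet> (A *v e j) = c" if "j \<in> W" for j
  proof -
    have "w \<bullet> (A *v e j) = (\<Sum>i\<in>UNIV. (A *v e j) $ i * c)"
      unfolding inner_vec_sum
    proof (rule sum.cong)
      fix i
      have "(A *v e j) $ i = 0" if "i \<notin> W"
        by (rule closed_under_mult[OF stochastic W_closed _ that]) (use \<open>j \<in> W\<close> in \<open>auto simp: axis_def\<close>)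
      then show "(A *v e j) $ i * w $ i = (A *v e j) $ i * c"
        using w by (cases "i \<in> W") auto
    qed simp
    then show ?thesis
      using column_prob_vec[of j] by (simp add: prob_vec_def flip: sum_distrib_right)
  qed
  have "M_equiv P A X (\<lambda>t \<omega>. state_vec v) Z'"
  proof (rule M_equivI)
    show "adapted P X (\<lambda>t \<omega>. state_vec v)"
      by (simp add: adapted_def)
    show "adapted P X Z'"
      using sol by (simp add: ergodic_solution_def)
    fix t
    show "AE \<omega> in P. (state_vec v - Z' t \<omega>) \<bullet> mart_diff A X t \<omega> = 0"
      using markovian_ergodic_solution(2)[OF sol Y', of t] AE_X_visited
    proof eventually_elim
      case (elim \<omega>)
      obtain j where j: "j \<in> W" "X t \<omega> = e j" using elim(2) by blast
      obtain i where i: "i \<in> W" "X (Suc t) \<omega> = e i" using elim(2) by blast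
      have "w \<bullet> mart_diff A X t \<omega> = 0"
        by (simp add: mart_diff_def j i inner_diff_right inner_axis w w_column)
      then show ?case
        using elim(1) by (simp add: w_def inner_diff_left)
    qed
  qed
  from that[OF indist this c] show ?thesis .
qed

end

section \<open>Existence, uniqueness and comparison for the ergodic equation\<close>

theorem theorem4p4:
  fixes P :: "'a measure" and X :: "nat \<Rightarrow> 'a \<Rightarrow> real ^ 'n::finite"
    and A :: "real ^ 'n ^ 'n" and \<gamma> :: real
    and f :: "real ^ 'n \<Rightarrow> real ^ 'n \<Rightarrow> real"
    and x0 :: "real ^ 'n"
    and v\<alpha> :: "real \<Rightarrow> real ^ 'n \<Rightarrow> real"
  assumes "prob_space P"
    and "sets P = sigma_sets (space P) (\<Union>t. sets (filt P X t))"
    and "markov_chain P X A"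
    and "uniformly_ergodic A"
    and "0 < \<gamma>" and "\<gamma> < 1"
    and "balanced P X A \<gamma> (\<lambda>\<omega> t z. f (X t \<omega>) z)"
    and "x0 \<in> states"
    and "\<And>\<alpha>. \<alpha> > 0 \<Longrightarrow> discounted_value P X A f \<alpha> (v\<alpha> \<alpha>)"
  shows "((\<forall>x\<in>states. visited P X x) \<longrightarrow>
            (\<exists>\<alpha> lam v. vanishing_discount_limit v\<alpha> x0 \<alpha> lam v)) \<and>
    (\<forall>\<alpha> lam v. vanishing_discount_limit v\<alpha> x0 \<alpha> lam v \<longrightarrow>
      (let Y = (\<lambda>t \<omega>. v (X t \<omega>)); Z = (\<lambda>t \<omega>. state_vec v) in
        ergodic_solution P X A f Y Z lam \<and> uniformly_bounded P Y \<and>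
        stationary_markovian P X Y Z \<and> v x0 = 0 \<and>
        (visited P X x0 \<longrightarrow>
          (\<forall>Y' Z' lam' v'.
            ergodic_solution P X A f Y' Z' lam' \<and> uniformly_bounded P Y' \<and>
            stationary_markovian P X Y' Z' \<and> represents P X v' Y' \<and> v' x0 = 0 \<longrightarrow>
            indistinguishable P Y Y' \<and> M_equiv P A X Z Z' \<and> lam = lam')) \<and>
        (\<forall>Y' Z' lam'.
          ergodic_solution P X A f Y' Z' lam' \<and> uniformly_bounded P Y' \<longrightarrow> lam = lam') \<and>
        (\<forall>Y' Z' lam'.
          ergodic_solution P X A f Y' Z' lam' \<and> uniformly_bounded P Y' \<and>
          stationary_markovian P X Y' Z' \<longrightarrow>
          (\<exists>c. indistinguishable P Y (\<lambda>t \<omega>. Y' t \<omega> + c)) \<and> M_equiv P A X Z Z')))"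
proof -
  interpret prob_space P by fact
  interpret balanced_chain P X A \<gamma> f
    by unfold_locales fact+
  obtain k0 where k0: "x0 = e k0"
    using assms(8) by (auto simp: states_def)
  show ?thesis
  proof (intro conjI allI impI)
    assume "\<forall>x\<in>states. visited P X x"
    then have "W = UNIV"
      by (auto simp: W_def states_def)
    then show "\<exists>\<alpha> lam v. vanishing_discount_limit v\<alpha> x0 \<alpha> lam v"
      using k0 assms(9) by (rule vanishing_discount_limit_exists)
  next
    fix \<alpha> lam v
    assume lim: "vanishing_discount_limit v\<alpha> x0 \<alpha> lam v"
    have v: "poisson v (\<lambda>x. lam)"
      by (rule vanishing_discount_poisson[OF assms(9) lim])
    note sol = poisson_ergodic_solution[OF v] and bdd = state_function_bounded[of v]
    have markov: "stationary_markovian P X (\<lambda>t \<omega>. v (X t \<omega>)) (\<lambda>t \<omega>. state_vec v)"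
      by (auto simp: stationary_markovian_def represents_def)
    have "(\<lambda>n. v\<alpha> (\<alpha> n) x0 - v\<alpha> (\<alpha> n) x0) \<longlonglongrightarrow> v x0"
      using lim assms(8) by (auto simp: vanishing_discount_limit_def)
    then have v_x0: "v x0 = 0"
      by (simp add: LIMSEQ_const_iff)
    \<comment> \<open>The comparison is applied in both directions; it covers bounded solutions that
      are not Markovian.\<close>
    have lam: "lam = lam'" if "ergodic_solution P X A f Y' Z' lam'" "uniformly_bounded P Y'" for Y' Z' lam'
      using ergodic_constant_le[OF sol that(1) bdd that(2)] ergodic_constant_le[OF that(1) sol that(2) bdd]
      by simp
    have unique: "\<exists>c. indistinguishable P (\<lambda>t \<omega>. v (X t \<omega>)) (\<lambda>t \<omega>. Y' t \<omega> + c) \<and>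
        M_equiv P A X (\<lambda>t \<omega>. state_vec v) Z' \<and> (\<forall>j\<in>W. v (e j) = v' (e j) + c)"
      if "ergodic_solution P X A f Y' Z' lam'" "uniformly_bounded P Y'" "represents P X v' Y'"
      for Y' Z' lam' v'
      using markovian_solution_unique[OF v _ that(3), of Z'] that(1) lam[OF that(1,2)] by metis
    have normalized: "indistinguishable P (\<lambda>t \<omega>. v (X t \<omega>)) Y' \<and>
        M_equiv P A X (\<lambda>t \<omega>. state_vec v) Z' \<and> lam = lam'"
      if x0: "visited P X x0" "v' x0 = 0"
        and Y': "ergodic_solution P X A f Y' Z' lam'" "uniformly_bounded P Y'" "represents P X v' Y'" for Y' Z' lam' v'
    proof -
      obtain c where c: "indistinguishable P (\<lambda>t \<omega>. v (X t \<omega>)) (\<lambda>t \<omega>. Y' t \<omega> + c)"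
        "M_equiv P A X (\<lambda>t \<omega>. state_vec v) Z'" "\<forall>j\<in>W. v (e j) = v' (e j) + c"
        using unique[OF Y'] by blast
      \<comment> \<open>As \<open>x0\<close> is visited, the relation on \<open>W\<close> can be
        read there, where both functions are \<open>0\<close>.\<close>
      have "c = 0"
        using c(3) x0 v_x0 by (simp add: k0 W_def)
      with c lam[OF Y'(1,2)] show ?thesis by simp
    qed
    have up_to_constant: "(\<exists>c. indistinguishable P (\<lambda>t \<omega>. v (X t \<omega>)) (\<lambda>t \<omega>. Y' t \<omega> + c)) \<and>
        M_equiv P A X (\<lambda>t \<omega>. state_vec v) Z'"
      if Y': "ergodic_solution P X A f Y' Z' lam'" "uniformly_bounded P Y'" "stationary_markovian P X Y' Z'"
      for Y' Z' lam'
    proof -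
      obtain v' where "represents P X v' Y'"
        using Y'(3) by (auto simp: stationary_markovian_def)
      from unique[OF Y'(1,2) this] show ?thesis by blast
    qed
    show "let Y = (\<lambda>t \<omega>. v (X t \<omega>)); Z = (\<lambda>t \<omega>. state_vec v) in
        ergodic_solution P X A f Y Z lam \<and> uniformly_bounded P Y \<and>
        stationary_markovian P X Y Z \<and> v x0 = 0 \<and>
        (visited P X x0 \<longrightarrow>
          (\<forall>Y' Z' lam' v'.
            ergodic_solution P X A f Y' Z' lam' \<and> uniformly_bounded P Y' \<and>
            stationary_markovian P X Y' Z' \<and> represents P X v' Y' \<and> v' x0 = 0 \<longrightarrow>
            indistinguishable P Y Y' \<and> M_equiv P A X Z Z' \<and> lam = lam')) \<and>
        (\<forall>Y' Z' lam'.
          ergodic_solution P X A f Y' Z' lam' \<and> uniformly_bounded P Y' \<longrightarrow> lam = lam') \<and>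
        (\<forall>Y' Z' lam'.
          ergodic_solution P X A f Y' Z' lam' \<and> uniformly_bounded P Y' \<and>
          stationary_markovian P X Y' Z' \<longrightarrow>
          (\<exists>c. indistinguishable P Y (\<lambda>t \<omega>. Y' t \<omega> + c)) \<and> M_equiv P A X Z Z')"
      unfolding Let_def using sol bdd markov v_x0 normalized lam up_to_constant by blast
  qed
qed

end
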